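(* Let $\Gamma$ be a finite abelian group of even order, and let $\sigma$ be an involution of $\Gamma$. Then there exist a positive integer $d$ and a centrally symmetric convex $d$-polytope $P$ in $\mathbb{E}^d$ such that $G(P)=\Gamma(P)=\Gamma$ and $\sigma$ is realized as the central symmetry of $P$; that is, there is an isomorphism $\Gamma\to G(P)$ (with $G(P)\to\Gamma(P)$ also an isomorphism) under which $\sigma$ corresponds to the map $x\mapsto -x$.
   Context: For a convex polytope $P$, $G(P)$ is the group of Euclidean isometries of $\mathbb{E}^d$ preserving $P$, and $\Gamma(P)$ is the group of combinatorial automorphisms of its face lattice; each symmetry induces an automorphism. $P$ is centrally symmetric if $-P=P$ (with respect to the origin). *)

theory Defs
  imports "HOL-Analysis.Analysis" "HOL-Algebra.Algebra"
begin

definition Ed :: "nat \<Rightarrow> (nat \<Rightarrow> real) set" where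
  "Ed d = {x. \<forall>i\<ge>d. x i = 0}"

definition ip :: "nat \<Rightarrow> (nat \<Rightarrow> real) \<Rightarrow> (nat \<Rightarrow> real) \<Rightarrow> real" where
  "ip d x y = (\<Sum>i<d. x i * y i)"

definition edist :: "nat \<Rightarrow> (nat \<Rightarrow> real) \<Rightarrow> (nat \<Rightarrow> real) \<Rightarrow> real" where
  "edist d x y = sqrt (\<Sum>i<d. (x i - y i)^2)"

definition conv_fin :: "(nat \<Rightarrow> real) set \<Rightarrow> (nat \<Rightarrow> real) set" where
  "conv_fin S = {x. \<exists>u. (\<forall>s\<in>S. 0 \<le> u s) \<and> sum u S = 1 \<and> x = (\<lambda>i. \<Sum>s\<in>S. u s * s i)}"

definition is_polytope :: "nat \<Rightarrow> (nat \<Rightarrow> real) set \<Rightarrow> bool" where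
  "is_polytope d P \<longleftrightarrow> (\<exists>S. finite S \<and> S \<subseteq> Ed d \<and> P = conv_fin S) \<and>
     (\<exists>c\<in>P. \<exists>e>0. \<forall>x\<in>Ed d. edist d x c < e \<longrightarrow> x \<in> P)"

text \<open>Faces of P (including the empty face and P itself): intersections with supporting hyperplanes.\<close>
definition faces :: "nat \<Rightarrow> (nat \<Rightarrow> real) set \<Rightarrow> (nat \<Rightarrow> real) set set" where
  "faces d P = {F. \<exists>a b. a \<in> Ed d \<and> (\<forall>x\<in>P. ip d a x \<le> b) \<and> F = {x\<in>P. ip d a x = b}}"

definition symmetries :: "nat \<Rightarrow> (nat \<Rightarrow> real) set \<Rightarrow> ((nat \<Rightarrow> real) \<Rightarrow> (nat \<Rightarrow> real)) set" where
  "symmetries d P = {f. f \<in> extensional (Ed d) \<and> bij_betw f (Ed d) (Ed d) \<and>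
      (\<forall>x\<in>Ed d. \<forall>y\<in>Ed d. edist d (f x) (f y) = edist d x y) \<and> f ` P = P}"

definition comb_auts :: "nat \<Rightarrow> (nat \<Rightarrow> real) set \<Rightarrow> ((nat \<Rightarrow> real) set \<Rightarrow> (nat \<Rightarrow> real) set) set" where
  "comb_auts d P = {\<alpha>. \<alpha> \<in> extensional (faces d P) \<and> bij_betw \<alpha> (faces d P) (faces d P) \<and>
      (\<forall>F\<in>faces d P. \<forall>G\<in>faces d P. F \<subseteq> G \<longleftrightarrow> \<alpha> F \<subseteq> \<alpha> G)}"

definition induced :: "nat \<Rightarrow> (nat \<Rightarrow> real) set \<Rightarrow> ((nat \<Rightarrow> real) \<Rightarrow> (nat \<Rightarrow> real)) \<Rightarrow> ((nat \<Rightarrow> real) set \<Rightarrow> (nat \<Rightarrow> real) set)" where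
  "induced d P f = restrict (\<lambda>F. f ` F) (faces d P)"

definition central_sym :: "(nat \<Rightarrow> real) \<Rightarrow> (nat \<Rightarrow> real)" where
  "central_sym x = (\<lambda>i. - x i)"

end

theory Submission
  imports Defs
begin

text \<open>Start with a graph on which \<open>\<Gamma>\<close> acts as the full automorphism group, freely on vertices and on edges,
  and such that \<open>\<sigma>\<close> moves every vertex to a non-neighbour. Take the cross-polytope
  whose vertices \<open>e x\<close> are the edges \<open>x\<close> of the graph, with \<open>e (\<sigma> x) = - e x\<close>, and for every vertex \<open>v\<close>
  of the graph add a new point just beyond the face spanned by the edges at \<open>v\<close>. In the 1-skeleton
  of the resulting polytope an old vertex misses at most three others (its antipode and the caps at the two
  ends of that antipode), whereas a new one misses at least four, so an automorphism of the face lattice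
  respects the distinction. It therefore preserves antipodes and the incidence
  of edges and vertices of the graph, and so comes from \<open>\<Gamma>\<close>, which acts linearly.
  The graph is a Frucht-type graph on \<open>\<Gamma> \<times> {0..|\<Gamma>|}\<close>, which requires \<open>|\<Gamma>| \<ge> 4\<close>; for \<open>|\<Gamma>| = 2\<close> the
  polytope is a segment.\<close>

section \<open>Isometries, faces and lattice automorphisms\<close>

text \<open>A cross-polytope alone has all signed permutations as symmetries; the caps cut these
  down, and the 1-skeleton suffices to see how. Among the old vertices only antipodes are not
  joined, and a cap is joined to every old vertex except the antipodes of its own edges, so
  non-adjacency reveals both the antipodal map and the incidences of the graph. A linear map
  commutes with the central symmetry, so \<open>\<sigma>\<close> has to be central; this is where
  commutativity of \<open>\<Gamma>\<close> enters. Antipodes are distinct, so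
  \<open>\<sigma>\<close> may fix no edge: every edge of the graph joins two different layers and
  \<open>\<Gamma>\<close> preserves layers, hence no edge is ever reversed. Consecutive layers are
  tied by the complement of a perfect matching. A matching would identify their copies of
  \<open>\<Gamma>\<close> equally well, but it would give layer 1 degree 2 and the last two layers
  the same degree. With the complement the smallest degree is \<open>|\<Gamma>|\<close>; that it is
  at least 4 supplies the four edges per vertex that the caps need, and it keeps the degree of layer
  0 above all others.\<close>

lemma ip_commute: "ip d x y = ip d y x"
  by (simp add: ip_def mult.commute)

lemma ip_scale_right: "ip d a (\<lambda>i. c * x i) = c * ip d a x"
  by (simp add: ip_def sum_distrib_left mult_ac)

lemma ip_scale_left: "ip d (\<lambda>i. c * x i) a = c * ip d x a"
  by (simp add: ip_def sum_distrib_left mult_ac)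

lemma ip_sum_right: "ip d a (\<lambda>i. \<Sum>s\<in>S. f s i) = (\<Sum>s\<in>S. ip d a (f s))"
  unfolding ip_def by (subst sum.swap) (simp add: sum_distrib_left)

lemma ip_sum_left: "ip d (\<lambda>i. \<Sum>s\<in>S. f s i) a = (\<Sum>s\<in>S. ip d (f s) a)"
  by (simp add: ip_commute[of d _ a] ip_sum_right)

lemma ip_diff_right: "ip d a (\<lambda>i. x i - y i) = ip d a x - ip d a y"
  by (simp add: ip_def sum_subtractf right_diff_distrib)

lemma ip_diff_left: "ip d (\<lambda>i. x i - y i) a = ip d x a - ip d y a"
  by (simp add: ip_def sum_subtractf left_diff_distrib)

lemma ip_uminus_left: "ip d (\<lambda>i. - x i) a = - ip d x a"
  by (simp add: ip_def sum_negf)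

lemma ip_uminus_right: "ip d a (\<lambda>i. - x i) = - ip d a x"
  by (simp add: ip_def sum_negf)

lemma ip_zero [simp]: "ip d (\<lambda>_. 0) x = 0" "ip d x (\<lambda>_. 0) = 0"
  by (simp_all add: ip_def)

lemma ip_self_nonneg: "0 \<le> ip d x x"
  by (simp add: ip_def sum_nonneg)

lemma ip_self_eq_0:
  assumes "x \<in> Ed d" "ip d x x = 0"
  shows "x = (\<lambda>_. 0)"
proof
  fix i
  have "\<forall>i\<in>{..<d}. x i * x i = 0"
    using assms(2) unfolding ip_def by (subst (asm) sum_nonneg_eq_0_iff) auto
  then show "x i = 0"
    using assms(1) by (cases "i < d") (auto simp: Ed_def)
qed

lemma edist_eq_ip: "edist d x y = sqrt (ip d (\<lambda>i. x i - y i) (\<lambda>i. x i - y i))"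
  by (simp add: edist_def ip_def power2_eq_square)

lemma edist_power2: "(edist d x y)\<^sup>2 = ip d x x - 2 * ip d x y + ip d y y"
proof -
  have "(edist d x y)\<^sup>2 = (\<Sum>i<d. (x i - y i)\<^sup>2)"
    by (simp add: edist_def sum_nonneg)
  also have "\<dots> = (\<Sum>i<d. x i * x i - 2 * (x i * y i) + y i * y i)"
    by (intro sum.cong) (auto simp: power2_eq_square algebra_simps)
  finally show ?thesis
    by (simp add: ip_def sum.distrib sum_subtractf sum_distrib_left)
qed

lemma zero_in_Ed: "(\<lambda>_. 0) \<in> Ed d" and diff_in_Ed: "x \<in> Ed d \<Longrightarrow> y \<in> Ed d \<Longrightarrow> (\<lambda>i. x i - y i) \<in> Ed d"
  by (auto simp: Ed_def)

section \<open>Symmetries acting on the face lattice\<close>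

text \<open>Polarization of the distances between \<open>x\<close>, \<open>y\<close> and the origin.
  A symmetry is not assumed to fix the origin, so the image of the origin is subtracted here and
  wherever a normal vector is moved.\<close>

lemma isometry_ip:
  assumes iso: "\<forall>x\<in>Ed d. \<forall>y\<in>Ed d. edist d (f x) (f y) = edist d x y"
    and "x \<in> Ed d" "y \<in> Ed d"
  shows "ip d (\<lambda>i. f x i - f (\<lambda>_. 0) i) (\<lambda>i. f y i - f (\<lambda>_. 0) i) = ip d x y"
proof -
  let ?o = "\<lambda>_::nat. 0::real"
  have "(edist d (f x) (f y))\<^sup>2 = (edist d x y)\<^sup>2"
    "(edist d (f x) (f ?o))\<^sup>2 = (edist d x ?o)\<^sup>2"
    "(edist d (f y) (f ?o))\<^sup>2 = (edist d y ?o)\<^sup>2"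
    using assms zero_in_Ed by auto
  then show ?thesis
    unfolding edist_power2
    by (simp add: ip_diff_right ip_diff_left ip_commute[of d "f ?o" "f y"])
qed

context
  fixes d P f
  assumes sym: "f \<in> symmetries d P" and P: "P \<subseteq> Ed d"
begin

lemma symmetry_in_Ed: "x \<in> Ed d \<Longrightarrow> f x \<in> Ed d"
  using sym by (auto simp: symmetries_def dest: bij_betwE)

lemma symmetry_ip:
  assumes "x \<in> Ed d" "y \<in> Ed d"
  shows "ip d (\<lambda>i. f y i - f (\<lambda>_. 0) i) (f x) = ip d y x + ip d (\<lambda>i. f y i - f (\<lambda>_. 0) i) (f (\<lambda>_. 0))"
  using isometry_ip[of d f y x] assms sym by (auto simp: symmetries_def ip_diff_right)

lemma symmetry_image_face:
  assumes "F \<in> faces d P"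
  shows "f ` F \<in> faces d P"
proof -
  obtain a b where a: "a \<in> Ed d" "\<forall>x\<in>P. ip d a x \<le> b" "F = {x\<in>P. ip d a x = b}"
    using assms by (auto simp: faces_def)
  \<comment> \<open>The normal moves by the linear part of \<open>f\<close>; the translation part
    only shifts the bound from \<open>b\<close> to \<open>b + c\<close>.\<close>
  define a' where "a' = (\<lambda>i. f a i - f (\<lambda>_. 0) i)"
  define c where "c = ip d a' (f (\<lambda>_. 0))"
  have ip: "ip d a' (f x) = ip d a x + c" if "x \<in> P" for x
    using symmetry_ip[of x a] that P a(1) by (auto simp: a'_def c_def)
  have fP: "f ` P = P"
    using sym by (simp add: symmetries_def)
  have "a' \<in> Ed d"
    unfolding a'_def using a(1) symmetry_in_Ed zero_in_Ed by (intro diff_in_Ed) auto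
  moreover have "\<forall>y\<in>P. ip d a' y \<le> b + c"
  proof
    fix y assume "y \<in> P"
    then obtain x where "x \<in> P" "y = f x"
      using fP by blast
    then show "ip d a' y \<le> b + c"
      using ip a(2) by simp
  qed
  moreover have "f ` F = {y\<in>P. ip d a' y = b + c}"
    unfolding a(3)
  proof (intro equalityI subsetI)
    fix y assume "y \<in> {y\<in>P. ip d a' y = b + c}"
    then obtain x where "x \<in> P" "y = f x" "ip d a' y = b + c"
      using fP by blast
    then show "y \<in> f ` {x\<in>P. ip d a x = b}"
      using ip by auto
  qed (use ip fP in auto)
  ultimately show ?thesis
    by (auto simp: faces_def)
qed

lemma symmetry_onto_faces:
  assumes "G \<in> faces d P"
  shows "\<exists>F\<in>faces d P. f ` F = G"
proof -
  obtain a b where a: "a \<in> Ed d" "\<forall>x\<in>P. ip d a x \<le> b" "G = {x\<in>P. ip d a x = b}"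
    using assms by (auto simp: faces_def)
  \<comment> \<open>The wanted normal is the preimage of \<open>a\<close> under the linear part of
    \<open>f\<close>, that is, the preimage of \<open>a\<close> plus the image of the origin under
    \<open>f\<close> itself.\<close>
  have "(\<lambda>i. a i + f (\<lambda>_. 0) i) \<in> f ` Ed d"
    using sym a(1) symmetry_in_Ed[OF zero_in_Ed] by (auto simp: symmetries_def bij_betw_def Ed_def)
  then obtain a' where a': "a' \<in> Ed d" "f a' = (\<lambda>i. a i + f (\<lambda>_. 0) i)"
    by auto
  define c where "c = ip d a (f (\<lambda>_. 0))"
  have ip: "ip d a (f x) = ip d a' x + c" if "x \<in> P" for x
    using symmetry_ip[of x a'] that P a' by (auto simp: c_def)
  have fP: "f ` P = P"
    using sym by (simp add: symmetries_def)
  have "\<forall>x\<in>P. ip d a' x \<le> b - c"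
  proof
    fix x assume "x \<in> P"
    then have "f x \<in> P"
      using fP by blast
    then show "ip d a' x \<le> b - c"
      using ip[OF \<open>x \<in> P\<close>] a(2) by fastforce
  qed
  moreover have "f ` {x\<in>P. ip d a' x = b - c} = G"
    unfolding a(3)
  proof (intro equalityI subsetI)
    fix y assume "y \<in> {x \<in> P. ip d a x = b}"
    then obtain x where "x \<in> P" "y = f x" "ip d a y = b"
      using fP by blast
    then show "y \<in> f ` {x\<in>P. ip d a' x = b - c}"
      using ip by auto
  qed (use ip fP in auto)
  ultimately show ?thesis
    using a'(1) by (intro bexI[of _ "{x\<in>P. ip d a' x = b - c}"]) (auto simp: faces_def)
qed

lemma symmetry_induced: "induced d P f \<in> comb_auts d P"
proof -
  have sub: "F \<subseteq> Ed d" if "F \<in> faces d P" for F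
    using that P by (auto simp: faces_def)
  have inj: "inj_on f (Ed d)"
    using sym by (auto simp: symmetries_def bij_betw_def)
  have "bij_betw (induced d P f) (faces d P) (faces d P)"
    unfolding bij_betw_def
  proof
    show "inj_on (induced d P f) (faces d P)"
    proof (rule inj_onI)
      fix F G assume "F \<in> faces d P" "G \<in> faces d P" "induced d P f F = induced d P f G"
      then show "F = G"
        using inj_on_image_eq_iff[OF inj sub sub] by (simp add: induced_def)
    qed
    show "induced d P f ` faces d P = faces d P"
      using symmetry_image_face symmetry_onto_faces by (fastforce simp: induced_def image_iff)
  qed
  then show ?thesis
    using sub inj by (auto simp: comb_auts_def induced_def inj_on_image_subset_iff)
qed

end

section \<open>Faces of the convex hull of a finite set\<close>

lemma conv_fin_in_Ed: "S \<subseteq> Ed d \<Longrightarrow> conv_fin S \<subseteq> Ed d"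
  by (fastforce simp: conv_fin_def Ed_def intro!: sum.neutral)

lemma subset_conv_fin:
  assumes "finite S"
  shows "S \<subseteq> conv_fin S"
proof
  fix s assume s: "s \<in> S"
  have "(\<Sum>t\<in>S. (if t = s then 1 else 0) * t i) = s i" for i
    using assms s by (simp add: if_distrib[of "\<lambda>c. c * _"] cong: if_cong)
  then show "s \<in> conv_fin S"
    using assms s unfolding conv_fin_def by (intro CollectI exI[of _ "\<lambda>t. if t = s then 1 else 0"]) auto
qed

lemma conv_fin_ip_le:
  assumes "x \<in> conv_fin S" "\<And>s. s \<in> S \<Longrightarrow> ip d a s \<le> b"
  shows "ip d a x \<le> b"
proof -
  obtain u where u: "\<forall>s\<in>S. 0 \<le> u s" "sum u S = 1" "x = (\<lambda>i. \<Sum>s\<in>S. u s * s i)"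
    using assms(1) by (auto simp: conv_fin_def)
  have "ip d a x = (\<Sum>s\<in>S. u s * ip d a s)"
    by (simp add: u(3) ip_sum_right ip_scale_right)
  also have "\<dots> \<le> (\<Sum>s\<in>S. u s * b)"
    using u(1) assms(2) by (intro sum_mono mult_left_mono) auto
  finally show ?thesis
    using u(2) by (simp flip: sum_distrib_right)
qed

lemma faceI:
  assumes "finite S" "a \<in> Ed d" "\<And>s. s \<in> S \<Longrightarrow> ip d a s \<le> b" 
  shows "\<exists>F\<in>faces d (conv_fin S). F \<inter> S = {s\<in>S. ip d a s = b}"
proof (rule bexI)
  show "{x\<in>conv_fin S. ip d a x = b} \<inter> S = {s\<in>S. ip d a s = b}"
    using subset_conv_fin[OF assms(1)] by auto
  show "{x\<in>conv_fin S. ip d a x = b} \<in> faces d (conv_fin S)"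
    using assms(2,3) conv_fin_ip_le[of _ S d a b] unfolding faces_def by blast
qed

lemma empty_face: "{} \<in> faces d P"
  unfolding faces_def
  by (intro CollectI exI[of _ "\<lambda>_. 0"] exI[of _ 1]) (auto simp: zero_in_Ed)

context
  fixes d S F
  assumes S: "finite S" and F: "F \<in> faces d (conv_fin S)"
begin

text \<open>The slacks \<open>b - ip d a t\<close> are nonnegative and their
  \<open>u\<close>-weighted sum is \<open>b - ip d a x = 0\<close>, so every point of nonzero weight
  has slack zero.\<close>

lemma face_support:
  assumes x: "x \<in> F" and u: "\<forall>s\<in>S. 0 \<le> u s" "sum u S = 1" "x = (\<lambda>i. \<Sum>s\<in>S. u s * s i)"
    and s: "s \<in> S" "u s \<noteq> 0"
  shows "s \<in> F"
proof -
  obtain a b where a: "\<forall>x\<in>conv_fin S. ip d a x \<le> b" "F = {x\<in>conv_fin S. ip d a x = b}"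
    using F by (auto simp: faces_def)
  have le: "ip d a t \<le> b" if "t \<in> S" for t
    using a(1) subset_conv_fin[OF S] that by auto
  have "(\<Sum>t\<in>S. u t * (b - ip d a t)) = b * sum u S - (\<Sum>t\<in>S. u t * ip d a t)"
    by (simp add: right_diff_distrib sum_subtractf sum_distrib_left mult.commute)
  also have "\<dots> = b - ip d a x"
    unfolding u(2) by (simp add: u(3) ip_sum_right ip_scale_right)
  also have "\<dots> = 0"
    using x a(2) by simp
  finally have "u s * (b - ip d a s) = 0"
    using sum_nonneg_eq_0_iff[OF S, of "\<lambda>t. u t * (b - ip d a t)"] u(1) le s(1) by auto
  then show ?thesis
    using s subset_conv_fin[OF S] a(2) by auto
qed

lemma face_combination:
  assumes u: "\<forall>s\<in>S. 0 \<le> u s" "sum u S = 1" and "\<And>s. s \<in> S \<Longrightarrow> u s \<noteq> 0 \<Longrightarrow> s \<in> F"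
  shows "(\<lambda>i. \<Sum>s\<in>S. u s * s i) \<in> F"
proof -
  obtain a b where a: "F = {x\<in>conv_fin S. ip d a x = b}"
    using F by (auto simp: faces_def)
  have "ip d a (\<lambda>i. \<Sum>s\<in>S. u s * s i) = (\<Sum>s\<in>S. u s * ip d a s)"
    by (simp add: ip_sum_right ip_scale_right)
  also have "\<dots> = (\<Sum>s\<in>S. u s * b)"
    using assms(3) a by (intro sum.cong) auto
  finally show ?thesis
    using u a by (auto simp: conv_fin_def simp flip: sum_distrib_right)
qed

lemma face_meets_vertices: "F \<noteq> {} \<Longrightarrow> F \<inter> S \<noteq> {}"
proof -
  assume "F \<noteq> {}"
  then obtain x where x: "x \<in> F" by auto
  then obtain u where u: "\<forall>s\<in>S. 0 \<le> u s" "sum u S = 1" "x = (\<lambda>i. \<Sum>s\<in>S. u s * s i)"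
    using F by (auto simp: faces_def conv_fin_def)
  then obtain s where "s \<in> S" "u s \<noteq> 0"
    using u(2) by (metis sum.neutral zero_neq_one)
  then show ?thesis
    using face_support[OF x u] by auto
qed

end

text \<open>This lets a face \<open>F\<close> be replaced by the finite set
  \<open>F \<inter> S\<close>: the points of nonzero weight in a combination for
  \<open>x \<in> F\<close> lie in \<open>F\<close>, hence in \<open>G\<close>.\<close>

lemma face_subset_if_vertices_subset:
  assumes S: "finite S" and F: "F \<in> faces d (conv_fin S)" and G: "G \<in> faces d (conv_fin S)"
    and sub: "F \<inter> S \<subseteq> G \<inter> S"
  shows "F \<subseteq> G"
proof
  fix x assume x: "x \<in> F"
  then obtain u where u: "\<forall>s\<in>S. 0 \<le> u s" "sum u S = 1" "x = (\<lambda>i. \<Sum>s\<in>S. u s * s i)"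
    using F by (auto simp: faces_def conv_fin_def)
  show "x \<in> G"
    unfolding u(3) using face_support[OF S F x u] sub by (intro face_combination[OF S G u(1,2)]) auto
qed

lemma face_eq_if_vertices_eq:
  assumes "finite S" "F \<in> faces d (conv_fin S)" "G \<in> faces d (conv_fin S)" "F \<inter> S = G \<inter> S"
  shows "F = G"
  using face_subset_if_vertices_subset[of S] assms by (metis subset_antisym order_refl)

section \<open>Lattice automorphisms as permutations of the vertices\<close>

text \<open>A face is determined by the points of \<open>S\<close> in it, so an automorphism of the
  lattice is encoded by a permutation of \<open>S\<close>. The condition is an equivalence so that
  sets which are not the vertex set of a face are respected too; non-adjacency in the 1-skeleton
  depends on this.\<close>

definition lattice_perm :: "nat \<Rightarrow> (nat \<Rightarrow> real) set \<Rightarrow> ((nat \<Rightarrow> real) \<Rightarrow> (nat \<Rightarrow> real)) \<Rightarrow> bool" where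
  "lattice_perm d S \<pi> \<longleftrightarrow> bij_betw \<pi> S S \<and>
     (\<forall>T\<subseteq>S. (\<exists>F\<in>faces d (conv_fin S). F \<inter> S = T) \<longleftrightarrow> (\<exists>F\<in>faces d (conv_fin S). F \<inter> S = \<pi> ` T))"

text \<open>The exposed singletons are the atoms of the lattice and the empty face is its bottom. An
  order automorphism fixes the bottom and permutes the atoms, and whether an atom lies below a face
  is a matter of order.\<close>

lemma comb_aut_lattice_perm:
  assumes S: "finite S" and exposed: "\<And>s. s \<in> S \<Longrightarrow> {s} \<in> faces d (conv_fin S)"
    and \<alpha>: "\<alpha> \<in> comb_auts d (conv_fin S)"
  shows "\<exists>\<pi>. lattice_perm d S \<pi> \<and> (\<forall>s\<in>S. \<alpha> {s} = {\<pi> s}) \<and> (\<forall>F\<in>faces d (conv_fin S). \<alpha> F \<inter> S = \<pi> ` (F \<inter> S))"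
proof -
  let ?L = "faces d (conv_fin S)"
  have bij: "bij_betw \<alpha> ?L ?L" and mono: "\<And>F G. F \<in> ?L \<Longrightarrow> G \<in> ?L \<Longrightarrow> F \<subseteq> G \<longleftrightarrow> \<alpha> F \<subseteq> \<alpha> G"
    using \<alpha> unfolding comb_auts_def by blast+
  have in_L: "\<alpha> F \<in> ?L" if "F \<in> ?L" for F
    using bij_betwE[OF bij] that by blast
  have onto: "\<exists>F\<in>?L. \<alpha> F = G" if "G \<in> ?L" for G
  proof -
    have "G \<in> \<alpha> ` ?L"
      using that bij_betw_imp_surj_on[OF bij] by simp
    then show ?thesis
      by blast
  qed
  have \<alpha>_empty: "\<alpha> {} = {}"
  proof -
    obtain G where "G \<in> ?L" "\<alpha> G = {}"
      using onto[OF empty_face] by blast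
    then show ?thesis
      using mono[OF empty_face, of G] by simp
  qed
  have "\<exists>s'\<in>S. \<alpha> {s} = {s'}" if s: "s \<in> S" for s
  proof -
    have "\<alpha> {s} \<noteq> {}"
      using mono[OF exposed[OF s] empty_face] \<alpha>_empty by simp
    then obtain s' where s': "s' \<in> S" "s' \<in> \<alpha> {s}"
      using face_meets_vertices[OF S in_L[OF exposed[OF s]]] by blast
    obtain G where G: "G \<in> ?L" "\<alpha> G = {s'}"
      using onto[OF exposed[OF s'(1)]] by blast
    then have "G \<subseteq> {s}"
      using mono[OF G(1) exposed[OF s]] s'(2) by simp
    moreover have "G \<noteq> {}"
      using G(2) \<alpha>_empty by force
    ultimately have "G = {s}" by auto
    then show ?thesis
      using G(2) s'(1) by auto
  qed
  then obtain \<pi> where \<pi>: "\<And>s. s \<in> S \<Longrightarrow> \<pi> s \<in> S" "\<And>s. s \<in> S \<Longrightarrow> \<alpha> {s} = {\<pi> s}"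
    by metis
  have "inj_on \<pi> S"
  proof (rule inj_onI)
    fix s t assume "s \<in> S" "t \<in> S" "\<pi> s = \<pi> t"
    then have "{s} \<subseteq> {t}"
      using mono[OF exposed exposed] \<pi>(2) by auto
    then show "s = t" by auto
  qed
  then have bij_\<pi>: "bij_betw \<pi> S S"
    using endo_inj_surj[OF S] \<pi>(1) by (simp add: bij_betw_def image_subset_iff)
  have mem: "\<pi> s \<in> \<alpha> F \<longleftrightarrow> s \<in> F" if "s \<in> S" "F \<in> ?L" for s F
    using mono[OF exposed[OF that(1)] that(2)] \<pi>(2)[OF that(1)] by auto
  have image: "\<alpha> F \<inter> S = \<pi> ` (F \<inter> S)" if F: "F \<in> ?L" for F
  proof (intro equalityI subsetI)
    fix t assume t: "t \<in> \<alpha> F \<inter> S"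
    then obtain s where "s \<in> S" "t = \<pi> s"
      using bij_\<pi> by (auto simp: bij_betw_def)
    then show "t \<in> \<pi> ` (F \<inter> S)"
      using mem[OF _ F] t by auto
  qed (use mem[OF _ F] \<pi>(1) in auto)
  have "(\<exists>F\<in>?L. F \<inter> S = T) \<longleftrightarrow> (\<exists>F\<in>?L. F \<inter> S = \<pi> ` T)" if T: "T \<subseteq> S" for T
  proof
    assume "\<exists>F\<in>?L. F \<inter> S = T"
    then show "\<exists>F\<in>?L. F \<inter> S = \<pi> ` T"
    proof
      fix F assume F: "F \<in> ?L" "F \<inter> S = T"
      then show ?thesis
        using image[OF F(1)] in_L[OF F(1)] by metis
    qed
  next
    assume "\<exists>F\<in>?L. F \<inter> S = \<pi> ` T"
    then obtain G where G: "G \<in> ?L" "G \<inter> S = \<pi> ` T"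
      by (elim bexE)
    obtain F where F: "F \<in> ?L" "\<alpha> F = G"
      using onto[OF G(1)] by blast
    have "\<pi> ` (F \<inter> S) = \<pi> ` T"
      using image[OF F(1)] F(2) G(2) by simp
    then have "F \<inter> S = T"
      using inj_on_image_eq_iff[OF bij_betw_imp_inj_on[OF bij_\<pi>], of "F \<inter> S" T] T by simp
    then show "\<exists>F\<in>?L. F \<inter> S = T"
      using F(1) by blast
  qed
  then have "lattice_perm d S \<pi>"
    unfolding lattice_perm_def using bij_\<pi> by (intro conjI allI impI)
  with \<pi>(2) image show ?thesis
    by (intro exI[of _ \<pi>] conjI ballI)
qed

definition solid :: "nat \<Rightarrow> (nat \<Rightarrow> real) set \<Rightarrow> bool" where
  "solid d P \<longleftrightarrow> (\<exists>c\<in>P. \<exists>e>0. \<forall>x\<in>Ed d. edist d x c < e \<longrightarrow> x \<in> P)"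

text \<open>The points \<open>f x\<close> and \<open>g x\<close> are equidistant from each
  \<open>g s\<close>, so \<open>w = f x - g x\<close>, if nonzero, would be normal to a hyperplane
  containing all \<open>g s\<close>. Pulled back along \<open>g\<close> this hyperplane contains
  \<open>S\<close>, which a hull with an interior point excludes.\<close>

lemma symmetry_eqI:
  assumes S: "S \<subseteq> Ed d" and solid: "solid d (conv_fin S)"
    and f: "f \<in> symmetries d (conv_fin S)" and g: "g \<in> symmetries d (conv_fin S)"
    and eq: "\<And>s. s \<in> S \<Longrightarrow> f s = g s"
  shows "f = g"
proof -
  let ?P = "conv_fin S"
  have "f x = g x" if x: "x \<in> Ed d" for x
  proof -
    have Ed: "f y \<in> Ed d" "g y \<in> Ed d" if "y \<in> Ed d" for y
      using f g that conv_fin_in_Ed[OF S] by (auto intro: symmetry_in_Ed)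
    define w where "w = (\<lambda>i. f x i - g x i)"
    have w: "w \<in> Ed d"
      unfolding w_def using Ed x by (intro diff_in_Ed)
    \<comment> \<open>The constant value of \<open>ip d w\<close> on the points equidistant from
      \<open>f x\<close> and \<open>g x\<close>.\<close>
    define k where "k = (ip d (f x) (f x) - ip d (g x) (g x)) / 2"
    have ws: "ip d w (g s) = k" if s: "s \<in> S" for s
    proof -
      have "s \<in> Ed d"
        using s S by blast
      then have "edist d (f x) (f s) = edist d (g x) (g s)"
        using f g x by (simp add: symmetries_def)
      then have "(edist d (f x) (f s))\<^sup>2 = (edist d (g x) (g s))\<^sup>2"
        by simp
      then show ?thesis
        unfolding edist_power2 eq[OF s] k_def w_def ip_diff_left by simp
    qed
    \<comment> \<open>\<open>v\<close> is the preimage of \<open>w\<close> under the linear part of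
      \<open>g\<close>.\<close>
    have "\<exists>v\<in>Ed d. \<forall>y\<in>Ed d. ip d w (g y) - ip d w (g (\<lambda>_. 0)) = ip d v y \<and> (v = (\<lambda>_. 0) \<longrightarrow> w = (\<lambda>_. 0))"
    proof -
      have "g ` Ed d = Ed d"
        using g by (simp add: symmetries_def bij_betw_def)
      moreover have "(\<lambda>i. w i + g (\<lambda>_. 0) i) \<in> Ed d"
        using w Ed(2)[OF zero_in_Ed] by (simp add: Ed_def)
      ultimately obtain v where v: "v \<in> Ed d" "g v = (\<lambda>i. w i + g (\<lambda>_. 0) i)"
        by (metis imageE)
      have "ip d w (g y) - ip d w (g (\<lambda>_. 0)) = ip d v y" if "y \<in> Ed d" for y
        using symmetry_ip[OF g conv_fin_in_Ed[OF S] that v(1)] v(2) by simp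
      moreover have "w = (\<lambda>_. 0)" if "v = (\<lambda>_. 0)"
      proof
        show "w i = 0" for i
          using fun_cong[OF v(2), of i] that by simp
      qed
      ultimately show ?thesis
        using v(1) by blast
    qed
    then obtain v where v: "v \<in> Ed d" "\<And>y. y \<in> Ed d \<Longrightarrow> ip d w (g y) - ip d w (g (\<lambda>_. 0)) = ip d v y"
      "v = (\<lambda>_. 0) \<Longrightarrow> w = (\<lambda>_. 0)"
      by blast
    define l where "l = k - ip d w (g (\<lambda>_. 0))"
    have vs: "ip d v s = l" if "s \<in> S" for s
      using v(2)[of s] ws[OF that] that S by (auto simp: l_def)
    have vP: "ip d v y = l" if "y \<in> ?P" for y
      using conv_fin_ip_le[OF that, of d v l] conv_fin_ip_le[OF that, of d "\<lambda>i. - v i" "- l"] vs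
      by (simp add: ip_uminus_left)
    obtain c e where c: "c \<in> ?P" "e > 0" "\<And>y. y \<in> Ed d \<Longrightarrow> edist d y c < e \<Longrightarrow> y \<in> ?P"
      using solid by (auto simp: solid_def)
    define n where "n = sqrt (ip d v v)"
    \<comment> \<open>Small enough that moving from \<open>c\<close> by \<open>\<delta>\<close>
      times \<open>v\<close> stays within distance \<open>e\<close>; the \<open>+ 1\<close> keeps
      the denominator positive when \<open>v\<close> is zero.\<close>
    define \<delta> where "\<delta> = e / (n + 1)"
    have n: "n \<ge> 0"
      by (simp add: n_def ip_self_nonneg)
    have \<delta>: "\<delta> > 0" "\<delta> * n < e"
      using n c(2) by (auto simp: \<delta>_def field_simps)
    define y where "y = (\<lambda>i. c i + \<delta> * v i)"
    have "edist d y c = \<delta> * n"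
      using \<delta>(1) by (simp add: edist_eq_ip y_def ip_scale_right ip_commute[of d "\<lambda>i. \<delta> * v i"] real_sqrt_mult n_def)
    moreover have "c \<in> Ed d"
      using c(1) conv_fin_in_Ed[OF S] by auto
    ultimately have "y \<in> ?P"
      using \<delta>(2) v(1) by (intro c(3)) (auto simp: y_def Ed_def)
    then have "ip d v y = ip d v c"
      using vP c(1) by simp
    moreover have "ip d v y = ip d v c + \<delta> * ip d v v"
      by (simp add: y_def ip_def sum.distrib sum_distrib_left algebra_simps)
    ultimately have "ip d v v = 0"
      using \<delta>(1) by simp
    then have "w = (\<lambda>_. 0)"
      using ip_self_eq_0[OF v(1)] v(3) by blast
    then show "f x = g x"
      by (auto simp: w_def fun_eq_iff)
  qed
  moreover have "f x = g x" if "x \<notin> Ed d" for x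
    using f g that by (auto simp: symmetries_def extensional_def)
  ultimately show ?thesis by blast
qed

text \<open>Symmetries and lattice automorphisms are both determined by their effect on
  \<open>S\<close>. Hence it suffices that \<open>L\<close> supplies every vertex permutation
  respecting the lattice: a symmetry induces such a permutation, agrees on \<open>S\<close> with
  some \<open>L a\<close>, and so equals it.\<close>

lemma realization:
  assumes S: "finite S" "S \<subseteq> Ed d" and solid: "solid d (conv_fin S)"
    and exposed: "\<And>s. s \<in> S \<Longrightarrow> {s} \<in> faces d (conv_fin S)"
    and L: "\<And>a. a \<in> C \<Longrightarrow> L a \<in> symmetries d (conv_fin S)" and inj: "inj_on L C"
    and perm: "\<And>\<pi>. lattice_perm d S \<pi> \<Longrightarrow> \<exists>a\<in>C. \<forall>s\<in>S. L a s = \<pi> s"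
  shows "bij_betw L C (symmetries d (conv_fin S))"
    and "bij_betw (induced d (conv_fin S)) (symmetries d (conv_fin S)) (comb_auts d (conv_fin S))"
proof -
  let ?P = "conv_fin S" and ?L = "faces d (conv_fin S)"
  note P = conv_fin_in_Ed[OF S(2)]
  have lift: "\<exists>a\<in>C. (\<forall>s\<in>S. \<alpha> {s} = {L a s}) \<and> induced d ?P (L a) = \<alpha>" if \<alpha>: "\<alpha> \<in> comb_auts d ?P" for \<alpha>
  proof -
    obtain \<pi> where \<pi>: "lattice_perm d S \<pi>" "\<forall>s\<in>S. \<alpha> {s} = {\<pi> s}" "\<forall>F\<in>?L. \<alpha> F \<inter> S = \<pi> ` (F \<inter> S)"
      using comb_aut_lattice_perm[OF S(1) exposed \<alpha>] by auto
    obtain a where a: "a \<in> C" "\<forall>s\<in>S. L a s = \<pi> s"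
      using perm[OF \<pi>(1)] by auto
    have "L a ` F = \<alpha> F" if F: "F \<in> ?L" for F
    proof (rule face_eq_if_vertices_eq[OF S(1)])
      show "L a ` F \<in> ?L"
        by (rule symmetry_image_face[OF L[OF a(1)] P F])
      show "\<alpha> F \<in> ?L"
        using \<alpha> F by (auto simp: comb_auts_def dest: bij_betwE)
      have "L a ` F \<inter> S = \<pi> ` (F \<inter> S)"
      proof (intro equalityI subsetI)
        fix t assume t: "t \<in> L a ` F \<inter> S"
        then obtain x where x: "x \<in> F" "t = L a x" by auto
        have "\<pi> ` S = S"
          using \<pi>(1) by (simp add: lattice_perm_def bij_betw_def)
        then obtain s where s: "s \<in> S" "t = \<pi> s"
          using t by blast
        have "F \<subseteq> conv_fin S"
          using F by (auto simp: faces_def)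
        then have "x \<in> Ed d" "s \<in> Ed d"
          using x(1) P s(1) S(2) by blast+
        then have "x = s"
          using inj_onD[of "L a" "Ed d" x s] x s a(2) L[OF a(1)] by (simp add: symmetries_def bij_betw_def)
        then show "t \<in> \<pi> ` (F \<inter> S)"
          using x(1) s by blast
      next
        fix t assume "t \<in> \<pi> ` (F \<inter> S)"
        then obtain s where s: "s \<in> F" "s \<in> S" "t = \<pi> s"
          by blast
        then have "t = L a s" "t \<in> S"
          using a(2) \<pi>(1) bij_betwE[of \<pi> S S] by (simp_all add: lattice_perm_def)
        then show "t \<in> L a ` F \<inter> S"
          using s by blast
      qed
      then show "L a ` F \<inter> S = \<alpha> F \<inter> S"
        using \<pi>(3) F by simp
    qed
    then have "induced d ?P (L a) = \<alpha>"
      using \<alpha> by (auto simp: induced_def comb_auts_def extensional_def fun_eq_iff)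
    moreover have "\<forall>s\<in>S. \<alpha> {s} = {L a s}"
      using a(2) \<pi>(2) by simp
    ultimately show ?thesis
      using a(1) by blast
  qed
  have ind: "induced d ?P f \<in> comb_auts d ?P" if "f \<in> symmetries d ?P" for f
    using symmetry_induced[OF that P] .
  have ind_vertex: "induced d ?P f {s} = {f s}" if "s \<in> S" for f s
    using exposed[OF that] by (simp add: induced_def)
  have "L ` C = symmetries d ?P"
  proof (intro equalityI subsetI)
    fix f assume f: "f \<in> symmetries d ?P"
    obtain a where a: "a \<in> C" "\<forall>s\<in>S. induced d ?P f {s} = {L a s}"
      using lift[OF ind[OF f]] by blast
    have "f = L a"
    proof (rule symmetry_eqI[OF S(2) solid f L[OF a(1)]])
      fix s assume "s \<in> S"
      then show "f s = L a s"
        using a(2) ind_vertex[of s f] by simp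
    qed
    then show "f \<in> L ` C"
      using a(1) by auto
  qed (use L in auto)
  then show "bij_betw L C (symmetries d ?P)"
    using inj by (simp add: bij_betw_def)
  have "inj_on (induced d ?P) (symmetries d ?P)"
  proof (rule inj_onI)
    fix f g assume fg: "f \<in> symmetries d ?P" "g \<in> symmetries d ?P" "induced d ?P f = induced d ?P g"
    show "f = g"
    proof (rule symmetry_eqI[OF S(2) solid fg(1,2)])
      fix s assume "s \<in> S"
      then show "f s = g s"
        using fg(3) ind_vertex[of s f] ind_vertex[of s g] by simp
    qed
  qed
  moreover have "comb_auts d ?P \<subseteq> induced d ?P ` symmetries d ?P"
  proof
    fix \<alpha> assume "\<alpha> \<in> comb_auts d ?P"
    then obtain a where "a \<in> C" "induced d ?P (L a) = \<alpha>"
      using lift by blast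
    then show "\<alpha> \<in> induced d ?P ` symmetries d ?P"
      using L by blast
  qed
  ultimately show "bij_betw (induced d ?P) (symmetries d ?P) (comb_auts d ?P)"
    using ind unfolding bij_betw_def by blast
qed

section \<open>Orthonormal frames with signs\<close>

text \<open>After numbering \<open>E\<close>, each pair \<open>{x, \<tau> x}\<close> contributes the
  member with the smaller number.\<close>

lemma fixpoint_free_involution_transversal:
  assumes E: "finite E" and \<tau>: "\<And>x. x \<in> E \<Longrightarrow> \<tau> x \<in> E" "\<And>x. x \<in> E \<Longrightarrow> \<tau> (\<tau> x) = x" "\<And>x. x \<in> E \<Longrightarrow> \<tau> x \<noteq> x"
  shows "\<exists>Y\<subseteq>E. E = Y \<union> \<tau> ` Y \<and> Y \<inter> \<tau> ` Y = {}"
proof -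
  obtain f :: "'a \<Rightarrow> nat" where f: "inj_on f E"
    using finite_imp_inj_to_nat_seg[OF E] by blast
  define Y where "Y = {x\<in>E. f x < f (\<tau> x)}"
  have "x \<in> Y \<or> \<tau> x \<in> Y" if "x \<in> E" for x
    using inj_onD[OF f, of x "\<tau> x"] that \<tau>[OF that] linorder_neq_iff[of "f x" "f (\<tau> x)"] by (auto simp: Y_def)
  then have "E \<subseteq> Y \<union> \<tau> ` Y"
    using \<tau>(2) by (metis UnCI image_eqI subsetI)
  moreover have "Y \<subseteq> E" "\<tau> ` Y \<subseteq> E" "Y \<inter> \<tau> ` Y = {}"
    using \<tau> by (auto simp: Y_def)
  ultimately show ?thesis
    by blast
qed

text \<open>An orthonormal basis together with its negatives, indexed so that \<open>\<tau>\<close>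
  becomes negation. No half of \<open>E\<close> is singled out, so a permutation commuting with
  \<open>\<tau>\<close> acts on the frame directly. The factor \<open>1 / 2\<close> in
  \<open>expansion\<close> compensates for every axis occurring twice.\<close>

locale signed_frame =
  fixes E :: "'x set" and \<tau> :: "'x \<Rightarrow> 'x" and d :: nat and e :: "'x \<Rightarrow> nat \<Rightarrow> real"
  assumes finite_E: "finite E" and E_nonempty: "E \<noteq> {}"
    and \<tau>_in: "x \<in> E \<Longrightarrow> \<tau> x \<in> E" and \<tau>_\<tau>: "x \<in> E \<Longrightarrow> \<tau> (\<tau> x) = x" and \<tau>_neq: "x \<in> E \<Longrightarrow> \<tau> x \<noteq> x"
    and e_in: "x \<in> E \<Longrightarrow> e x \<in> Ed d" and e_\<tau>: "x \<in> E \<Longrightarrow> e (\<tau> x) = (\<lambda>i. - e x i)"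
    and ip_e: "x \<in> E \<Longrightarrow> y \<in> E \<Longrightarrow> ip d (e x) (e y) = (if x = y then 1 else if x = \<tau> y then - 1 else 0)"
    and expansion: "v \<in> Ed d \<Longrightarrow> v = (\<lambda>i. \<Sum>x\<in>E. (ip d v (e x) / 2) * e x i)"

lemma signed_frame_exists:
  fixes E :: "'x set"
  assumes E: "finite E" "E \<noteq> {}"
    and \<tau>: "\<And>x. x \<in> E \<Longrightarrow> \<tau> x \<in> E" "\<And>x. x \<in> E \<Longrightarrow> \<tau> (\<tau> x) = x" "\<And>x. x \<in> E \<Longrightarrow> \<tau> x \<noteq> x"
  shows "\<exists>d e. d > 0 \<and> signed_frame E \<tau> d e"
proof -
  obtain Y where Y: "Y \<subseteq> E" "E = Y \<union> \<tau> ` Y" "Y \<inter> \<tau> ` Y = {}"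
    using fixpoint_free_involution_transversal[OF E(1) \<tau>] by blast
  have fin_Y: "finite Y"
    using Y(1) E(1) by (rule finite_subset)
  obtain k where k: "bij_betw k Y {..<card Y}"
    using ex_bij_betw_finite_nat[OF fin_Y] by (auto simp: atLeast0LessThan)
  define d where "d = card Y"
  have k_lt: "k y < d" if "y \<in> Y" for y
    using bij_betwE[OF k] that by (auto simp: d_def)
  have k_inj: "k y = k z \<longleftrightarrow> y = z" if "y \<in> Y" "z \<in> Y" for y z
    using inj_on_eq_iff[OF bij_betw_imp_inj_on[OF k]] that by blast
  have k_onto: "\<exists>y\<in>Y. k y = i" if "i < d" for i
    using bij_betw_imp_surj_on[OF k] that unfolding d_def by (metis imageE lessThan_iff)
  define e where "e x = (if x \<in> Y then (\<lambda>i. if i = k x then 1 else 0) else (\<lambda>i. if i = k (\<tau> x) then - 1 else (0::real)))" for x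
  have eY: "e y = (\<lambda>i. if i = k y then 1 else 0)" and e\<tau>Y: "e (\<tau> y) = (\<lambda>i. if i = k y then - 1 else 0)" if "y \<in> Y" for y
    using that Y \<tau>(2) by (auto simp: e_def)
  have cases: "x \<in> Y \<or> (\<exists>y\<in>Y. x = \<tau> y)" if "x \<in> E" for x
    using that Y(2) by blast
  have \<tau>Y: "\<tau> y \<notin> Y" "\<tau> (\<tau> y) = y" if "y \<in> Y" for y
    using that Y \<tau>(2) by auto
  have ip_Y: "ip d v (e y) = v (k y)" "ip d v (e (\<tau> y)) = - v (k y)" if "y \<in> Y" for v y
    using that k_lt[OF that] by (simp_all add: ip_def eY e\<tau>Y if_distrib[of "\<lambda>c. _ * c"] cong: if_cong)
  have inj_\<tau>: "inj_on \<tau> Y"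
    using \<tau>Y(2) by (metis inj_onI)
  have "signed_frame E \<tau> d e"
  proof
    fix x assume x: "x \<in> E"
    show "e x \<in> Ed d"
      using cases[OF x] k_lt by (auto simp: eY e\<tau>Y Ed_def simp flip: not_less)
    show "e (\<tau> x) = (\<lambda>i. - e x i)"
      using cases[OF x] by (auto simp: eY e\<tau>Y \<tau>Y(2))
    fix y assume y: "y \<in> E"
    show "ip d (e x) (e y) = (if x = y then 1 else if x = \<tau> y then - 1 else 0)"
    proof -
      have ne: "u \<noteq> \<tau> w" "\<tau> w \<noteq> u" "\<tau> u = \<tau> w \<longleftrightarrow> u = w" if "u \<in> Y" "w \<in> Y" for u w
        using that \<tau>Y by (blast, blast, metis)
      show ?thesis
        using cases[OF x] cases[OF y]
        by (elim disjE bexE; simp add: ip_Y ne \<tau>Y(2); auto simp: eY e\<tau>Y k_inj)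
    qed
  next
    fix v assume v: "v \<in> Ed d"
    show "v = (\<lambda>i. \<Sum>x\<in>E. (ip d v (e x) / 2) * e x i)"
    proof
      fix i
      have "(\<Sum>x\<in>E. (ip d v (e x) / 2) * e x i) = (\<Sum>y\<in>Y. (ip d v (e y) / 2) * e y i) + (\<Sum>y\<in>\<tau> ` Y. (ip d v (e y) / 2) * e y i)"
        unfolding Y(2) using fin_Y Y(3) by (intro sum.union_disjoint) auto
      also have "(\<Sum>y\<in>\<tau> ` Y. (ip d v (e y) / 2) * e y i) = (\<Sum>y\<in>Y. (ip d v (e (\<tau> y)) / 2) * e (\<tau> y) i)"
        by (subst sum.reindex[OF inj_\<tau>]) simp
      also have "(\<Sum>y\<in>Y. (ip d v (e y) / 2) * e y i) + \<dots> = (\<Sum>y\<in>Y. if i = k y then v i else 0)"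
        unfolding sum.distrib[symmetric] by (intro sum.cong refl; simp add: ip_Y; auto simp: eY e\<tau>Y)
      also have "\<dots> = v i"
      proof (cases "i < d")
        case True
        then obtain z where z: "z \<in> Y" "k z = i"
          using k_onto by blast
        then have "(\<Sum>y\<in>Y. if i = k y then v i else 0) = (\<Sum>y\<in>Y. if z = y then v i else 0)"
          using k_inj by (intro sum.cong) auto
        then show ?thesis
          using z(1) fin_Y by simp
      next
        case False
        then have "v i = 0"
          using v by (auto simp: Ed_def)
        then show ?thesis
          by (auto intro: sum.neutral)
      qed
      finally show "v i = (\<Sum>x\<in>E. (ip d v (e x) / 2) * e x i)" ..
    qed
  qed (use E \<tau> in auto)
  moreover have "d > 0"
    using E(2) Y(2) fin_Y by (auto simp: d_def card_gt_0_iff)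
  ultimately show ?thesis by blast
qed

context signed_frame
begin

section \<open>Coordinates with respect to a signed frame\<close>

lemma e_inj: "inj_on e E"
proof (rule inj_onI)
  fix x y assume "x \<in> E" "y \<in> E" "e x = e y"
  then show "x = y"
    using ip_e[of x y] ip_e[of x x] by (auto split: if_splits)
qed

lemma ip_e_\<tau>: "x \<in> E \<Longrightarrow> ip d v (e (\<tau> x)) = - ip d v (e x)"
  by (simp add: e_\<tau> ip_uminus_right)

lemma \<tau>_bij: "bij_betw \<tau> E E"
  by (rule bij_betw_byWitness[of _ \<tau>]) (auto simp: \<tau>_in \<tau>_\<tau>)

lemma sum_odd:
  fixes f :: "'x \<Rightarrow> real"
  assumes "\<And>x. x \<in> E \<Longrightarrow> f (\<tau> x) = - f x"
  shows "sum f E = 0"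
proof -
  have "sum f E = (\<Sum>x\<in>E. f (\<tau> x))"
    using sum.reindex_bij_betw[OF \<tau>_bij, of f] by simp
  also have "\<dots> = - sum f E"
    using assms by (simp add: sum_negf)
  finally show ?thesis by simp
qed

lemma sum_e: "(\<Sum>x\<in>E. e x i) = 0"
  by (rule sum_odd) (simp add: e_\<tau>)

lemma Ed_eqI:
  assumes "v \<in> Ed d" "w \<in> Ed d" "\<And>x. x \<in> E \<Longrightarrow> ip d v (e x) = ip d w (e x)"
  shows "v = w"
  by (subst expansion[OF assms(1)], subst expansion[OF assms(2)]) (simp add: assms(3))

lemma ip_parseval:
  assumes "w \<in> Ed d"
  shows "ip d v w = (\<Sum>x\<in>E. ip d v (e x) * ip d w (e x)) / 2"
proof -
  have "ip d v w = (\<Sum>x\<in>E. (ip d w (e x) / 2) * ip d v (e x))"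
    by (subst expansion[OF assms]) (simp only: ip_sum_right ip_scale_right)
  then show ?thesis
    by (simp add: sum_divide_distrib mult.commute)
qed

text \<open>Functionals are prescribed by their values on the frame, oddness being the only
  constraint. All supporting hyperplanes of the capped polytope are constructed in this way.\<close>

lemma functional_exists:
  fixes wt :: "'x \<Rightarrow> real"
  assumes odd: "\<And>x. x \<in> E \<Longrightarrow> wt (\<tau> x) = - wt x"
  shows "\<exists>a\<in>Ed d. \<forall>x\<in>E. ip d a (e x) = wt x"
proof (intro bexI ballI)
  let ?a = "\<lambda>i. \<Sum>y\<in>E. (wt y / 2) * e y i"
  show "?a \<in> Ed d"
    using e_in by (auto simp: Ed_def intro!: sum.neutral)
  fix x assume x: "x \<in> E"
  have "ip d ?a (e x) = (\<Sum>y\<in>E. (wt y / 2) * ip d (e x) (e y))"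
    by (subst ip_commute) (simp only: ip_sum_right ip_scale_right)
  also have "\<dots> = (\<Sum>y\<in>E. (if y = x then wt x / 2 else 0) + (if y = \<tau> x then wt x / 2 else 0))"
  proof (intro sum.cong refl)
    fix y assume y: "y \<in> E"
    then have "x = \<tau> y \<longleftrightarrow> y = \<tau> x"
      using \<tau>_\<tau> x by metis
    then show "(wt y / 2) * ip d (e x) (e y) = (if y = x then wt x / 2 else 0) + (if y = \<tau> x then wt x / 2 else 0)"
      using x y \<tau>_neq[OF x] odd[OF x] by (auto simp: ip_e)
  qed
  also have "\<dots> = wt x"
    using x \<tau>_in finite_E by (simp add: sum.distrib)
  finally show "ip d ?a (e x) = wt x" .
qed

lemma ip_e_le_edist:
  assumes "v \<in> Ed d" "x \<in> E"
  shows "\<bar>ip d v (e x)\<bar> \<le> edist d v (\<lambda>_. 0)"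
proof -
  \<comment> \<open>Both \<open>x\<close> and \<open>\<tau> x\<close> contribute the same square,
    which cancels the factor \<open>1 / 2\<close> in \<open>ip_parseval\<close>.\<close>
  have "(\<Sum>y\<in>{x, \<tau> x}. (ip d v (e y))\<^sup>2) \<le> (\<Sum>y\<in>E. (ip d v (e y))\<^sup>2)"
    using finite_E assms(2) \<tau>_in by (intro sum_mono2) auto
  then have "(ip d v (e x))\<^sup>2 \<le> ip d v v"
    using assms(2) \<tau>_neq[OF assms(2)] ip_parseval[OF assms(1), of v] by (simp add: ip_e_\<tau> power2_eq_square)
  then show ?thesis
    by (simp add: edist_eq_ip real_le_rsqrt flip: real_sqrt_abs)
qed

text \<open>The weight \<open>1 / card E\<close> at every vertex is a representation of the origin; odd perturbations of
  it represent a neighbourhood.\<close>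

lemma solid_if_frame_subset:
  assumes S: "finite S" "e ` E \<subseteq> S"
  shows "solid d (conv_fin S)"
proof -
  let ?n = "real (card E)"
  have n: "?n > 0"
    using finite_E E_nonempty by (simp add: card_gt_0_iff)
  \<comment> \<open>Within radius \<open>2 / ?n\<close> every coordinate is smaller than
    \<open>2 / ?n\<close> in absolute value, so the perturbed weights
    \<open>1 / ?n + ip d v (e x) / 2\<close> stay nonnegative.\<close>
  have near: "v \<in> conv_fin S" if v: "v \<in> Ed d" "edist d v (\<lambda>_. 0) < 2 / ?n" for v
  proof -
    define c where "c x = 1 / ?n + ip d v (e x) / 2" for x
    define u where "u s = (if s \<in> e ` E then c (the_inv_into E e s) else 0)" for s
    have c: "c x \<ge> 0" if "x \<in> E" for x
      using ip_e_le_edist[OF v(1) that] v(2) by (simp add: c_def)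
    have u_e: "u (e x) = c x" if "x \<in> E" for x
      using that e_inj by (simp add: u_def the_inv_into_f_f)
    have sum_u: "(\<Sum>s\<in>S. u s * g s) = (\<Sum>x\<in>E. c x * g (e x))" for g
    proof -
      have "(\<Sum>s\<in>S. u s * g s) = (\<Sum>s\<in>e ` E. u s * g s)"
        using S by (intro sum.mono_neutral_right) (auto simp: u_def)
      then show ?thesis
        using u_e by (simp add: sum.reindex[OF e_inj])
    qed
    have "(\<Sum>x\<in>E. ip d v (e x) / 2) = 0"
      by (rule sum_odd) (simp add: ip_e_\<tau>)
    then have "sum u S = 1"
      using sum_u[of "\<lambda>_. 1"] n by (simp add: c_def sum.distrib)
    moreover have "v = (\<lambda>i. \<Sum>s\<in>S. u s * s i)"
    proof
      fix i
      have "(\<Sum>s\<in>S. u s * s i) = (\<Sum>x\<in>E. e x i) / ?n + (\<Sum>x\<in>E. (ip d v (e x) / 2) * e x i)"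
        by (simp add: sum_u c_def distrib_right sum.distrib sum_divide_distrib)
      then show "v i = (\<Sum>s\<in>S. u s * s i)"
        using sum_e[of i] fun_cong[OF expansion[OF v(1)], of i] by simp
    qed
    moreover have "\<forall>s\<in>S. 0 \<le> u s"
      using c u_e by (auto simp: u_def)
    ultimately show ?thesis
      unfolding conv_fin_def by blast
  qed
  have "edist d (\<lambda>_. 0) (\<lambda>_. 0) = 0"
    by (simp add: edist_def)
  then have "(\<lambda>_. 0) \<in> conv_fin S"
    using n by (intro near zero_in_Ed) simp
  then show ?thesis
    using near n unfolding solid_def by (intro bexI[of _ "\<lambda>_. 0"] exI[of _ "2 / ?n"]) auto
qed

section \<open>Linear maps induced by permutations commuting with \<open>\<tau>\<close>\<close>

definition perm_map :: "('x \<Rightarrow> 'x) \<Rightarrow> (nat \<Rightarrow> real) \<Rightarrow> (nat \<Rightarrow> real)" where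
  "perm_map q = restrict (\<lambda>v i. \<Sum>x\<in>E. (ip d v (e x) / 2) * e (q x) i) (Ed d)"

lemma perm_map_combination:
  assumes "finite S" "S \<subseteq> Ed d"
  shows "perm_map q (\<lambda>i. \<Sum>s\<in>S. u s * s i) = (\<lambda>i. \<Sum>s\<in>S. u s * perm_map q s i)"
proof
  fix i
  have "(\<lambda>i. \<Sum>s\<in>S. u s * s i) \<in> Ed d"
    using assms by (fastforce simp: Ed_def intro!: sum.neutral)
  then have "perm_map q (\<lambda>i. \<Sum>s\<in>S. u s * s i) i = (\<Sum>x\<in>E. (ip d (\<lambda>i. \<Sum>s\<in>S. u s * s i) (e x) / 2) * e (q x) i)"
    by (simp add: perm_map_def)
  also have "\<dots> = (\<Sum>x\<in>E. \<Sum>s\<in>S. u s * ((ip d s (e x) / 2) * e (q x) i))"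
    by (simp only: ip_sum_left ip_scale_left sum_divide_distrib sum_distrib_right times_divide_eq_right[symmetric] mult.assoc)
  also have "\<dots> = (\<Sum>s\<in>S. u s * perm_map q s i)"
    using assms(2) by (subst sum.swap) (auto simp: perm_map_def sum_distrib_left intro!: sum.cong)
  finally show "perm_map q (\<lambda>i. \<Sum>s\<in>S. u s * s i) i = (\<Sum>s\<in>S. u s * perm_map q s i)" .
qed

context
  fixes q
  assumes q: "bij_betw q E E" and q_\<tau>: "\<And>x. x \<in> E \<Longrightarrow> q (\<tau> x) = \<tau> (q x)"
begin

lemma perm_in: "x \<in> E \<Longrightarrow> q x \<in> E"
  using bij_betwE[OF q] by blast

lemma perm_map_in: "v \<in> Ed d \<Longrightarrow> perm_map q v \<in> Ed d"
  using e_in perm_in by (auto simp: perm_map_def Ed_def intro!: sum.neutral)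

text \<open>Since \<open>q\<close> commutes with \<open>\<tau>\<close>, it preserves all inner
  products of frame vectors. The resulting rule for coordinates replaces explicit computation with
  the sum defining \<open>perm_map\<close>.\<close>

lemma ip_perm_map:
  assumes v: "v \<in> Ed d" and x: "x \<in> E"
  shows "ip d (perm_map q v) (e (q x)) = ip d v (e x)"
proof -
  have "ip d (perm_map q v) (e (q x)) = (\<Sum>y\<in>E. (ip d v (e y) / 2) * ip d (e (q x)) (e (q y)))"
    using v unfolding perm_map_def by (subst ip_commute) (simp only: restrict_apply if_True ip_sum_right ip_scale_right)
  also have "\<dots> = (\<Sum>y\<in>E. (ip d v (e y) / 2) * ip d (e x) (e y))"
  proof (intro sum.cong refl)
    fix y assume y: "y \<in> E"
    have "q x = q y \<longleftrightarrow> x = y" "q x = \<tau> (q y) \<longleftrightarrow> x = \<tau> y"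
      using inj_on_eq_iff[OF bij_betw_imp_inj_on[OF q]] x y \<tau>_in[OF y] q_\<tau>[OF y] by metis+
    then show "(ip d v (e y) / 2) * ip d (e (q x)) (e (q y)) = (ip d v (e y) / 2) * ip d (e x) (e y)"
      using x y by (simp add: ip_e perm_in)
  qed
  also have "\<dots> = ip d (e x) v"
    using ip_parseval[OF v, of "e x"] by (simp add: sum_divide_distrib mult.commute)
  finally show ?thesis
    by (simp add: ip_commute)
qed

lemma perm_map_e:
  assumes "x \<in> E"
  shows "perm_map q (e x) = e (q x)"
proof (rule Ed_eqI)
  fix y assume "y \<in> E"
  then obtain z where z: "z \<in> E" "y = q z"
    using bij_betw_imp_surj_on[OF q] by blast
  have "q x = q z \<longleftrightarrow> x = z" "q x = \<tau> (q z) \<longleftrightarrow> x = \<tau> z"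
    using inj_on_eq_iff[OF bij_betw_imp_inj_on[OF q]] assms z(1) \<tau>_in[OF z(1)] q_\<tau>[OF z(1)] by metis+
  then show "ip d (perm_map q (e x)) (e y) = ip d (e (q x)) (e y)"
    using assms z by (simp add: ip_perm_map e_in ip_e perm_in)
qed (use assms perm_map_in e_in perm_in in auto)

lemma perm_map_ip:
  assumes "v \<in> Ed d" "w \<in> Ed d"
  shows "ip d (perm_map q v) (perm_map q w) = ip d v w"
proof -
  have "ip d (perm_map q v) (perm_map q w) = (\<Sum>x\<in>E. ip d (perm_map q v) (e (q x)) * ip d (perm_map q w) (e (q x))) / 2"
    using sum.reindex_bij_betw[OF q, of "\<lambda>x. ip d (perm_map q v) (e x) * ip d (perm_map q w) (e x)"]
    by (simp add: ip_parseval[OF perm_map_in[OF assms(2)]])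
  then show ?thesis
    using assms by (simp add: ip_perm_map ip_parseval[OF assms(2)])
qed

lemma perm_map_inj: "inj_on (perm_map q) (Ed d)"
proof (rule inj_onI)
  fix v w assume vw: "v \<in> Ed d" "w \<in> Ed d" "perm_map q v = perm_map q w"
  then show "v = w"
    using ip_perm_map[OF vw(1)] ip_perm_map[OF vw(2)] by (intro Ed_eqI) auto
qed

lemma perm_map_symmetry:
  assumes S: "finite S" "S \<subseteq> Ed d" "perm_map q ` S = S"
  shows "perm_map q \<in> symmetries d (conv_fin S)"
proof -
  have iso: "edist d (perm_map q v) (perm_map q w) = edist d v w" if "v \<in> Ed d" "w \<in> Ed d" for v w
  proof -
    have "(edist d (perm_map q v) (perm_map q w))\<^sup>2 = (edist d v w)\<^sup>2"
      using that by (simp add: edist_power2 perm_map_ip)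
    then show ?thesis
      by (simp add: edist_eq_ip ip_self_nonneg)
  qed
  note inj = perm_map_inj
  have surj: "w \<in> perm_map q ` Ed d" if w: "w \<in> Ed d" for w
  proof -
    \<comment> \<open>The coordinates of \<open>w\<close> pulled back along \<open>q\<close>; they
      are odd because \<open>q\<close> commutes with \<open>\<tau>\<close>.\<close>
    obtain v where v: "v \<in> Ed d" "\<forall>x\<in>E. ip d v (e x) = ip d w (e (q x))"
      using functional_exists[of "\<lambda>x. ip d w (e (q x))"] by (auto simp: q_\<tau> ip_e_\<tau> perm_in)
    have "perm_map q v = w"
    proof (rule Ed_eqI[OF perm_map_in[OF v(1)] w])
      fix y assume "y \<in> E"
      then obtain x where "x \<in> E" "y = q x"
        using bij_betw_imp_surj_on[OF q] by blast
      then show "ip d (perm_map q v) (e y) = ip d w (e y)"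
        using v by (simp add: ip_perm_map)
    qed
    then show ?thesis
      using v(1) by blast
  qed
  have inj_S: "inj_on (perm_map q) S"
    using inj S(2) by (rule inj_on_subset)
  have push: "(\<lambda>i. \<Sum>s\<in>S. u (perm_map q s) * perm_map q s i) = (\<lambda>i. \<Sum>s\<in>S. u s * s i)"
    "(\<Sum>s\<in>S. u (perm_map q s)) = sum u S" for u
    using sum.reindex[OF inj_S, of "\<lambda>s. u s * s _"] sum.reindex[OF inj_S, of u] by (simp_all add: S(3))
  have "perm_map q ` conv_fin S = conv_fin S"
  proof (intro equalityI subsetI)
    fix y assume "y \<in> perm_map q ` conv_fin S"
    then obtain u where u: "\<forall>s\<in>S. 0 \<le> u s" "sum u S = 1" "y = perm_map q (\<lambda>i. \<Sum>s\<in>S. u s * s i)"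
      by (auto simp: conv_fin_def)
    define u' where "u' = u \<circ> the_inv_into S (perm_map q)"
    have u': "u' (perm_map q s) = u s" if "s \<in> S" for s
      using that inj_S by (simp add: u'_def the_inv_into_f_f)
    have "y = (\<lambda>i. \<Sum>s\<in>S. u' (perm_map q s) * perm_map q s i)"
      unfolding u(3) perm_map_combination[OF S(1,2)] using u' by (intro ext sum.cong) auto
    moreover have "sum u' S = 1"
      using push(2)[of u'] u' u(2) by simp
    moreover have "\<forall>s\<in>S. 0 \<le> u' s"
      using u(1) u' S(3) by (metis imageE)
    ultimately show "y \<in> conv_fin S"
      unfolding push(1) conv_fin_def by blast
  next
    fix y assume "y \<in> conv_fin S"
    then obtain u where u: "\<forall>s\<in>S. 0 \<le> u s" "sum u S = 1" "y = (\<lambda>i. \<Sum>s\<in>S. u s * s i)"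
      by (auto simp: conv_fin_def)
    let ?x = "\<lambda>i. \<Sum>s\<in>S. u (perm_map q s) * s i"
    have "y = perm_map q ?x"
      unfolding perm_map_combination[OF S(1,2)] push(1) u(3) ..
    moreover have "?x \<in> conv_fin S"
      unfolding conv_fin_def using u(1,2) push(2)[of u] S(3)
      by (intro CollectI exI[of _ "\<lambda>s. u (perm_map q s)"]) auto
    ultimately show "y \<in> perm_map q ` conv_fin S"
      by blast
  qed
  moreover have "perm_map q \<in> extensional (Ed d)"
    by (simp add: perm_map_def)
  moreover have "bij_betw (perm_map q) (Ed d) (Ed d)"
    using inj surj perm_map_in unfolding bij_betw_def by blast
  ultimately show ?thesis
    using iso by (simp add: symmetries_def)
qed

end

lemma perm_map_compose:
  assumes p: "bij_betw p E E" "\<And>x. x \<in> E \<Longrightarrow> p (\<tau> x) = \<tau> (p x)"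
    and q: "bij_betw q E E" "\<And>x. x \<in> E \<Longrightarrow> q (\<tau> x) = \<tau> (q x)"
    and r: "\<And>x. x \<in> E \<Longrightarrow> r x = p (q x)"
  shows "perm_map r = compose (Ed d) (perm_map p) (perm_map q)"
proof -
  have r': "bij_betw r E E"
    using bij_betw_trans[OF q(1) p(1)] by (subst bij_betw_cong[of _ _ "p \<circ> q"]) (auto simp: r)
  have perm_in: "q x \<in> E" if "x \<in> E" for x
    using bij_betwE[OF q(1)] that by blast
  have r_\<tau>: "r (\<tau> x) = \<tau> (r x)" if "x \<in> E" for x
    using that by (simp add: r \<tau>_in p(2) q(2) perm_in)
  show ?thesis
  proof (rule extensionalityI[of _ "Ed d"])
    fix v assume v: "v \<in> Ed d"
    have "perm_map r v = perm_map p (perm_map q v)"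
    proof (rule Ed_eqI)
      fix y assume "y \<in> E"
      then obtain x where x: "x \<in> E" "y = r x"
        using bij_betw_imp_surj_on[OF r'] by blast
      have "ip d (perm_map r v) (e y) = ip d v (e x)"
        using ip_perm_map[OF r' r_\<tau> v x(1)] x(2) by simp
      moreover have "ip d (perm_map p (perm_map q v)) (e (p (q x))) = ip d v (e x)"
        using ip_perm_map[OF p perm_map_in[OF q v] perm_in[OF x(1)]] ip_perm_map[OF q v x(1)] by simp
      ultimately show "ip d (perm_map r v) (e y) = ip d (perm_map p (perm_map q v)) (e y)"
        using x by (simp add: r)
    qed (use perm_map_in[OF r' r_\<tau>] perm_map_in[OF p] perm_map_in[OF q] v in auto)
    then show "perm_map r v = compose (Ed d) (perm_map p) (perm_map q) v"
      using v by (simp add: compose_def)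
  qed (auto simp: perm_map_def compose_def)
qed

lemma perm_map_\<tau>:
  assumes q: "\<And>x. x \<in> E \<Longrightarrow> q x = \<tau> x"
  shows "perm_map q = restrict central_sym (Ed d)"
proof (rule extensionalityI[of _ "Ed d"])
  fix v assume v: "v \<in> Ed d"
  have "perm_map q v = (\<lambda>i. - (\<Sum>x\<in>E. (ip d v (e x) / 2) * e x i))"
    using v by (auto simp: perm_map_def q e_\<tau> simp flip: sum_negf)
  also have "\<dots> = (\<lambda>i. - v i)"
    using fun_cong[OF expansion[OF v]] by simp
  also have "\<dots> = restrict central_sym (Ed d) v"
    using v by (simp add: central_sym_def)
  finally show "perm_map q v = restrict central_sym (Ed d) v" .
qed (auto simp: perm_map_def)

end

section \<open>Cross-polytopes with caps\<close>

definition realizes_centrally :: "('a, 'b) monoid_scheme \<Rightarrow> 'a \<Rightarrow> nat \<Rightarrow> (nat \<Rightarrow> real) set \<Rightarrow> bool" where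
  "realizes_centrally G \<sigma> d P \<longleftrightarrow>
     is_polytope d P \<and> central_sym ` P = P \<and>
     (\<exists>\<phi>. bij_betw \<phi> (carrier G) (symmetries d P) \<and>
          (\<forall>a\<in>carrier G. \<forall>b\<in>carrier G. \<phi> (a \<otimes>\<^bsub>G\<^esub> b) = compose (Ed d) (\<phi> a) (\<phi> b)) \<and>
          \<phi> \<sigma> = restrict central_sym (Ed d)) \<and>
     bij_betw (induced d P) (symmetries d P) (comb_auts d P)"

text \<open>To be read with \<open>E\<close> as the edges of a graph, \<open>V\<close> as its
  vertices and \<open>A v\<close> as the edges at \<open>v\<close>. The lower bound 4 serves twice:
  it exceeds the at most three non-neighbours of an old vertex, and it makes
  \<open>card (A v) - 1\<close> exceed the bound 2 in \<open>weight_face\<close>.\<close>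

locale cap_config = signed_frame E \<tau> d e
  for E :: "'x set" and \<tau> d e +
  fixes V :: "'v set" and A :: "'v \<Rightarrow> 'x set"
  assumes finite_V: "finite V" and A_subset: "v \<in> V \<Longrightarrow> A v \<subseteq> E"
    and A_\<tau>: "v \<in> V \<Longrightarrow> x \<in> A v \<Longrightarrow> \<tau> x \<notin> A v"
    and card_A: "v \<in> V \<Longrightarrow> 4 \<le> card (A v)"
    and card_A_Int: "v \<in> V \<Longrightarrow> w \<in> V \<Longrightarrow> v \<noteq> w \<Longrightarrow> card (A v \<inter> A w) \<le> 1"
    and card_incident: "x \<in> E \<Longrightarrow> card {v\<in>V. x \<in> A v} \<le> 2"
begin

text \<open>The factor exceeds \<open>1 / card (A v)\<close>, so \<open>cap v\<close> lies just beyond the face of the cross-polytope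
  spanned by \<open>e ` A v\<close>.\<close>

definition cap :: "'v \<Rightarrow> nat \<Rightarrow> real" where
  "cap v = (\<lambda>i. \<Sum>x\<in>A v. (1 / (real (card (A v)) - 1)) * e x i)"

definition verts :: "(nat \<Rightarrow> real) set" where
  "verts = e ` E \<union> cap ` V"

lemma finite_A: "v \<in> V \<Longrightarrow> finite (A v)"
  using finite_subset[OF A_subset finite_E] .

lemma ip_cap: "ip d a (cap v) = (\<Sum>x\<in>A v. ip d a (e x)) / (real (card (A v)) - 1)"
  by (simp only: cap_def ip_sum_right ip_scale_right) (simp add: sum_divide_distrib)

lemma finite_verts: "finite verts"
  by (simp add: verts_def finite_E finite_V)

lemma cap_in: "v \<in> V \<Longrightarrow> cap v \<in> Ed d"
  using A_subset e_in by (fastforce simp: cap_def Ed_def intro!: sum.neutral)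

lemma verts_in: "verts \<subseteq> Ed d"
  using e_in cap_in by (auto simp: verts_def)

text \<open>The hyperplane is the level 1 of the functional with values \<open>h\<close> on
  \<open>B\<close>, the opposite values on the antipodes, and 0 elsewhere. By the normalization of
  caps, \<open>cap v\<close> reaches level 1 exactly when its weights add up to
  \<open>card (A v) - 1\<close>. A cap outside \<open>U\<close> collects at most 2, which is less
  than \<open>card (A w) - 1\<close>.\<close>

lemma weight_face:
  assumes B: "B \<subseteq> E" "\<And>x. x \<in> B \<Longrightarrow> \<tau> x \<notin> B" and h: "\<And>x. x \<in> B \<Longrightarrow> 0 \<le> h x \<and> h x \<le> (1::real)"
    and U: "U \<subseteq> V" "\<And>v. v \<in> U \<Longrightarrow> A v \<subseteq> B" "\<And>v. v \<in> U \<Longrightarrow> sum h (A v) = real (card (A v)) - 1"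
    and small: "\<And>w. w \<in> V - U \<Longrightarrow> card (A w \<inter> B) \<le> 2"
  shows "\<exists>F\<in>faces d (conv_fin verts). F \<inter> verts = e ` {x\<in>B. h x = 1} \<union> cap ` U"
proof -
  define wt where "wt x = (if x \<in> B then h x else if \<tau> x \<in> B then - h (\<tau> x) else 0)" for x
  have "wt (\<tau> x) = - wt x" if "x \<in> E" for x
    using that B(2) \<tau>_\<tau>[OF that] by (auto simp: wt_def)
  then obtain a where a: "a \<in> Ed d" "\<And>x. x \<in> E \<Longrightarrow> ip d a (e x) = wt x"
    using functional_exists[of wt] by blast
  have wt_le: "wt x \<le> 1" for x
    using h[of x] h[of "\<tau> x"] by (auto simp: wt_def)
  have wt_neg: "wt x \<le> 0" if "x \<notin> B" for x
    using that h[of "\<tau> x"] by (auto simp: wt_def)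
  have wt_1: "wt x = 1 \<longleftrightarrow> x \<in> B \<and> h x = 1" for x
    using h[of "\<tau> x"] by (auto simp: wt_def)
  have cap_eq: "ip d a (cap v) = sum wt (A v) / (real (card (A v)) - 1)" if "v \<in> V" for v
    using A_subset[OF that] a(2) by (simp add: ip_cap subset_iff)
  have cap_U: "ip d a (cap v) = 1" if v: "v \<in> U" for v
  proof -
    have "sum wt (A v) = sum h (A v)"
      using U(2)[OF v] by (intro sum.cong) (auto simp: wt_def)
    then show ?thesis
      using v U(1,3) card_A[of v] cap_eq[of v] by auto
  qed
  have cap_V: "ip d a (cap w) < 1" if w: "w \<in> V - U" for w
  proof -
    have "sum wt (A w) \<le> (\<Sum>x\<in>A w. if x \<in> B then 1 else 0)"
      using wt_le wt_neg by (intro sum_mono) auto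
    also have "\<dots> = card (A w \<inter> B)"
      using w finite_A by (simp add: sum.If_cases Int_def)
    also have "\<dots> \<le> 2"
      using small[OF w] by simp
    finally have "sum wt (A w) < real (card (A w)) - 1"
      using card_A[of w] w by simp
    then show ?thesis
      using w card_A[of w] by (simp add: cap_eq)
  qed
  have "{s\<in>verts. ip d a s = 1} = e ` {x\<in>B. h x = 1} \<union> cap ` U"
    using a(2) wt_1 cap_U cap_V U(1) B(1) unfolding verts_def by fastforce
  moreover have "ip d a s \<le> 1" if "s \<in> verts" for s
    using that a(2) wt_le cap_U cap_V unfolding verts_def by fastforce
  ultimately show ?thesis
    using faceI[OF finite_verts a(1), of 1] by auto
qed

section \<open>The 1-skeleton\<close>

definition joined :: "(nat \<Rightarrow> real) \<Rightarrow> (nat \<Rightarrow> real) \<Rightarrow> bool" where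
  "joined s t \<longleftrightarrow> (\<exists>F\<in>faces d (conv_fin verts). F \<inter> verts = {s, t})"

lemma joined_commute: "joined s t = joined t s"
  by (simp add: joined_def insert_commute)

lemma joined_e_e:
  assumes "x \<in> E" "y \<in> E" "y \<noteq> \<tau> x"
  shows "joined (e x) (e y)"
proof -
  have "\<tau> z \<notin> {x, y}" if "z \<in> {x, y}" for z
    using that assms \<tau>_neq \<tau>_\<tau> by auto
  moreover have "card (A w \<inter> {x, y}) \<le> 2" for w
    using card_mono[of "{x, y}" "A w \<inter> {x, y}"] by (simp add: card_insert_if split: if_splits)
  moreover have "{z. z = x \<or> z = y} = {x, y}"
    by blast
  ultimately show ?thesis
    using weight_face[of "{x, y}" "\<lambda>_. 1" "{}"] assms by (simp add: joined_def)
qed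

lemma joined_cap_e:
  assumes v: "v \<in> V" and x: "x \<in> E" "\<tau> x \<notin> A v"
  shows "joined (cap v) (e x)"
proof -
  let ?m = "real (card (A v))"
  note m = card_A[OF v]
  \<comment> \<open>\<open>x\<close> needs weight 1, all other elements of \<open>A v\<close> weight
    below 1, and the total over \<open>A v\<close> must be \<open>?m - 1\<close>. If
    \<open>x \<in> A v\<close>, the remaining \<open>?m - 2\<close> is spread over the other
    \<open>?m - 1\<close> elements; otherwise \<open>?m - 1\<close> is spread over all
    \<open>?m\<close>.\<close>
  define h where "h y = (if y = x then 1 else if x \<in> A v then (?m - 2) / (?m - 1) else (?m - 1) / ?m)" for y
  have "sum h (A v) = ?m - 1"
  proof (cases "x \<in> A v")
    case True
    have "sum h (A v) = h x + (\<Sum>y\<in>A v - {x}. h y)"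
      using True finite_A[OF v] by (simp add: sum.remove)
    also have "(\<Sum>y\<in>A v - {x}. h y) = (\<Sum>y\<in>A v - {x}. (?m - 2) / (?m - 1))"
      using True by (intro sum.cong) (auto simp: h_def)
    also have "h x + \<dots> = 1 + (?m - 2)"
      using True m finite_A[OF v] by (simp add: h_def of_nat_diff)
    finally show ?thesis by simp
  next
    case False
    then have "sum h (A v) = (\<Sum>y\<in>A v. (?m - 1) / ?m)"
      by (intro sum.cong) (auto simp: h_def)
    then show ?thesis
      using m by simp
  qed
  moreover have "\<tau> z \<notin> insert x (A v)" if "z \<in> insert x (A v)" for z
    using that A_\<tau>[OF v] x \<tau>_neq \<tau>_\<tau> A_subset[OF v] by auto
  moreover have "card (A w \<inter> insert x (A v)) \<le> 2" if "w \<in> V - {v}" for w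
  proof -
    have "card (A w \<inter> insert x (A v)) \<le> card (insert x (A w \<inter> A v))"
      using that finite_A by (intro card_mono) auto
    also have "\<dots> \<le> Suc (card (A w \<inter> A v))"
      by (rule card_insert_le_m1) auto
    finally show ?thesis
      using card_A_Int[of w v] that v by auto
  qed
  moreover have "0 \<le> h z \<and> h z \<le> 1" for z
    using m by (simp add: h_def)
  ultimately have "\<exists>F\<in>faces d (conv_fin verts). F \<inter> verts = e ` {z\<in>insert x (A v). h z = 1} \<union> cap ` {v}"
    using v x A_subset[OF v] by (intro weight_face) auto
  moreover have "{z\<in>insert x (A v). h z = 1} = {x}"
    using m by (auto simp: h_def)
  ultimately show ?thesis
    by (simp add: joined_def insert_commute)
qed

lemma exposed_vertex:
  assumes "s \<in> verts"
  shows "{s} \<in> faces d (conv_fin verts)"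
proof -
  have "\<exists>F\<in>faces d (conv_fin verts). F \<inter> verts = {s}"
  proof (cases "s \<in> e ` E")
    case True
    then obtain x where "x \<in> E" "s = e x" by blast
    then show ?thesis
      using joined_e_e[of x x] \<tau>_neq[of x] by (auto simp: joined_def)
  next
    case False
    then obtain v where v: "v \<in> V" "s = cap v"
      using assms by (auto simp: verts_def)
    let ?h = "\<lambda>_. (real (card (A v)) - 1) / real (card (A v))"
    have "\<exists>F\<in>faces d (conv_fin verts). F \<inter> verts = e ` {x\<in>A v. ?h x = 1} \<union> cap ` {v}"
    proof (rule weight_face)
      show "card (A w \<inter> A v) \<le> 2" if "w \<in> V - {v}" for w
        using card_A_Int[of w v] that v(1) by auto
    qed (use v(1) A_subset A_\<tau> card_A[OF v(1)] in auto)
    moreover have "{x\<in>A v. ?h x = 1} = {}"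
      using card_A[OF v(1)] by auto
    ultimately show ?thesis
      using v(2) by simp
  qed
  then obtain F where F: "F \<in> faces d (conv_fin verts)" "F \<inter> verts = {s}"
    by blast
  have "F \<subseteq> {s}"
  proof
    fix y assume y: "y \<in> F"
    then obtain u where u: "\<forall>t\<in>verts. 0 \<le> u t" "sum u verts = 1" "y = (\<lambda>i. \<Sum>t\<in>verts. u t * t i)"
      using F(1) by (auto simp: faces_def conv_fin_def)
    have "u t = 0" if "t \<in> verts - {s}" for t
      using face_support[OF finite_verts F(1) y u, of t] that F(2) by auto
    then have "sum u verts = u s" "y = (\<lambda>i. u s * s i)"
      using assms finite_verts unfolding u(3) by (auto simp: sum.remove)
    then show "y \<in> {s}"
      using u(2) by simp
  qed
  then have "F = {s}"
    using F(2) by auto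
  then show ?thesis
    using F(1) by simp
qed

text \<open>If \<open>b\<close> is the level of the face, all frame vectors lie between
  \<open>- b\<close> and \<open>b\<close>, and \<open>e x\<close> lies at \<open>- b\<close>. If
  \<open>e x\<close> is in the face, \<open>b = - b\<close>. If \<open>cap v\<close> is, the star
  must total \<open>(?m - 1) * b\<close> although \<open>x\<close> contributes \<open>- b\<close>
  and the others at most \<open>(?m - 1) * b\<close>. Either way \<open>b = 0\<close> and the
  functional vanishes on all vertices. This is no contradiction, as the polytope itself counts as a
  face.\<close>

lemma antipodal_in_face:
  assumes F: "F \<in> faces d (conv_fin verts)" and v: "v \<in> V" and x: "x \<in> E"
    and mem: "e (\<tau> x) \<in> F" "e x \<in> F \<or> x \<in> A v \<and> cap v \<in> F"
  shows "verts \<subseteq> F"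
proof -
  obtain a b where a: "\<forall>y\<in>conv_fin verts. ip d a y \<le> b" "F = {y\<in>conv_fin verts. ip d a y = b}"
    using F by (auto simp: faces_def)
  note sub = subset_conv_fin[OF finite_verts]
  have le: "ip d a (e y) \<le> b" if "y \<in> E" for y
    using that a(1) sub by (auto simp: verts_def)
  have ge: "- b \<le> ip d a (e y)" if "y \<in> E" for y
    using le[OF \<tau>_in[OF that]] by (simp add: ip_e_\<tau> that)
  have b0: "b \<ge> 0"
    using le[OF x] ge[OF x] by simp
  have ax: "ip d a (e x) = - b"
    using mem(1) a(2) by (auto simp: ip_e_\<tau> x)
  have "b = 0"
    using mem(2)
  proof
    assume "e x \<in> F"
    then show ?thesis
      using a(2) ax by auto
  next
    let ?m = "real (card (A v))"
    have m: "?m \<ge> 4"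
      using card_A[OF v] by simp
    assume xv: "x \<in> A v \<and> cap v \<in> F"
    have "b * (?m - 1) = (\<Sum>y\<in>A v. ip d a (e y))"
      using xv a(2) m by (auto simp: ip_cap field_simps)
    also have "\<dots> = - b + (\<Sum>y\<in>A v - {x}. ip d a (e y))"
      using xv finite_A[OF v] ax sum.remove[of "A v" x "\<lambda>y. ip d a (e y)"] by simp
    also have "(\<Sum>y\<in>A v - {x}. ip d a (e y)) \<le> (\<Sum>y\<in>A v - {x}. b)"
      using A_subset[OF v] le by (intro sum_mono) auto
    also have "(\<Sum>y\<in>A v - {x}. b) = (?m - 1) * b"
      using xv finite_A[OF v] m by (simp add: of_nat_diff)
    finally show "b = 0"
      using b0 by (simp add: mult.commute)
  qed
  then have "ip d a (e y) = 0" if "y \<in> E" for y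
    using le[OF that] ge[OF that] by simp
  then have "ip d a s = 0" if "s \<in> verts" for s
    using that A_subset by (fastforce simp: verts_def ip_cap intro!: sum.neutral)
  then show ?thesis
    using sub a(2) \<open>b = 0\<close> by auto
qed

context
  assumes V_nonempty: "V \<noteq> {}"
begin

text \<open>The whole polytope is a face, so this inference needs more than two vertices: the ends
  of a segment are antipodal and yet joined. A single star already provides four vertices.\<close>

lemma not_joinedI:
  assumes "\<And>F. F \<in> faces d (conv_fin verts) \<Longrightarrow> s \<in> F \<Longrightarrow> t \<in> F \<Longrightarrow> verts \<subseteq> F"
  shows "\<not> joined s t"
proof
  assume "joined s t"
  then obtain F where F: "F \<in> faces d (conv_fin verts)" "F \<inter> verts = {s, t}"
    by (auto simp: joined_def)
  then have "verts \<subseteq> {s, t}"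
    using assms by blast
  then have "card (e ` E) \<le> card {s, t}"
    by (intro card_mono) (auto simp: verts_def)
  moreover have "card {s, t} \<le> 2"
    by (simp add: card_insert_if)
  moreover obtain v where v: "v \<in> V"
    using V_nonempty by blast
  then have "4 \<le> card (e ` E)"
    using card_A card_mono[OF finite_E A_subset] by (fastforce simp: card_image[OF e_inj])
  ultimately show False
    by simp
qed

lemma joined_e_e_iff:
  assumes "x \<in> E" "y \<in> E"
  shows "joined (e x) (e y) \<longleftrightarrow> y \<noteq> \<tau> x"
proof -
  obtain v where "v \<in> V"
    using V_nonempty by blast
  then have "\<not> joined (e x) (e (\<tau> x))"
    using assms(1) by (intro not_joinedI antipodal_in_face) auto
  then show ?thesis
    using joined_e_e[OF assms] by blast
qed

lemma joined_cap_e_iff: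
  assumes "v \<in> V" "x \<in> E"
  shows "joined (cap v) (e x) \<longleftrightarrow> \<tau> x \<notin> A v"
proof -
  have "\<not> joined (cap v) (e x)" if "\<tau> x \<in> A v"
    using that assms \<tau>_in \<tau>_\<tau>[OF assms(2)] antipodal_in_face[OF _ assms(1), of _ "\<tau> x"]
    by (intro not_joinedI) auto
  then show ?thesis
    using joined_cap_e[OF assms] by blast
qed

lemma incidence_eqI:
  assumes v: "v \<in> V" "w \<in> V" and iff: "\<And>x. x \<in> E \<Longrightarrow> x \<in> A v \<longleftrightarrow> x \<in> A w"
  shows "v = w"
proof (rule ccontr)
  assume "v \<noteq> w"
  then have "card (A v \<inter> A w) \<le> 1"
    using card_A_Int v by blast
  moreover have "A v \<inter> A w = A v"
    using iff A_subset v by blast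
  ultimately show False
    using card_A[OF v(1)] by simp
qed

lemma cap_inj: "inj_on cap V"
proof (rule inj_onI)
  fix v w assume vw: "v \<in> V" "w \<in> V" "cap v = cap w"
  show "v = w"
  proof (rule incidence_eqI[OF vw(1,2)])
    fix x assume "x \<in> E"
    then show "x \<in> A v \<longleftrightarrow> x \<in> A w"
      using joined_cap_e_iff[OF vw(1), of "\<tau> x"] joined_cap_e_iff[OF vw(2), of "\<tau> x"] vw(3) \<tau>_\<tau> \<tau>_in by auto
  qed
qed

definition nonjoined :: "(nat \<Rightarrow> real) \<Rightarrow> (nat \<Rightarrow> real) set" where
  "nonjoined s = {t\<in>verts. \<not> joined s t}"

lemma card_nonjoined_e:
  assumes "x \<in> E"
  shows "card (nonjoined (e x)) \<le> 3"
proof -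
  let ?W = "{v\<in>V. \<tau> x \<in> A v}"
  have "nonjoined (e x) \<subseteq> insert (e (\<tau> x)) (cap ` ?W)"
  proof
    fix t assume t: "t \<in> nonjoined (e x)"
    then consider y where "y \<in> E" "t = e y" | v where "v \<in> V" "t = cap v"
      by (auto simp: nonjoined_def verts_def)
    then show "t \<in> insert (e (\<tau> x)) (cap ` ?W)"
    proof cases
      case 1
      then show ?thesis
        using t assms joined_e_e by (auto simp: nonjoined_def)
    next
      case 2
      then show ?thesis
        using t assms joined_cap_e joined_commute[of "e x"] by (auto simp: nonjoined_def)
    qed
  qed
  then have "card (nonjoined (e x)) \<le> card (insert (e (\<tau> x)) (cap ` ?W))"
    using finite_V by (intro card_mono) auto
  also have "\<dots> \<le> Suc (card (cap ` ?W))"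
    by (simp add: card_insert_if finite_V)
  also have "card (cap ` ?W) \<le> card ?W"
    using finite_V by (intro card_image_le) auto
  also have "card ?W \<le> 2"
    using card_incident[OF \<tau>_in[OF assms]] .
  finally show ?thesis by simp
qed

lemma card_nonjoined_cap:
  assumes "v \<in> V"
  shows "4 \<le> card (nonjoined (cap v))"
proof -
  have sub: "A v \<subseteq> E"
    by (rule A_subset[OF assms])
  have inj: "inj_on (e \<circ> \<tau>) (A v)"
  proof (rule inj_onI)
    fix x y assume xy: "x \<in> A v" "y \<in> A v" "(e \<circ> \<tau>) x = (e \<circ> \<tau>) y"
    have E: "x \<in> E" "y \<in> E"
      using xy(1,2) sub by auto
    have "\<tau> x = \<tau> y"
      using inj_onD[OF e_inj, of "\<tau> x" "\<tau> y"] xy(3) \<tau>_in[OF E(1)] \<tau>_in[OF E(2)] by simp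
    then show "x = y"
      using \<tau>_\<tau>[OF E(1)] \<tau>_\<tau>[OF E(2)] by metis
  qed
  have "(e \<circ> \<tau>) ` A v \<subseteq> nonjoined (cap v)"
  proof
    fix t assume "t \<in> (e \<circ> \<tau>) ` A v"
    then obtain x where x: "x \<in> A v" "t = e (\<tau> x)"
      by auto
    then have "x \<in> E"
      using sub by blast
    then show "t \<in> nonjoined (cap v)"
      using x joined_cap_e_iff[OF assms \<tau>_in] by (simp add: nonjoined_def verts_def \<tau>_in \<tau>_\<tau>)
  qed
  moreover have "finite (nonjoined (cap v))"
    using finite_verts by (simp add: nonjoined_def)
  ultimately have "card (A v) \<le> card (nonjoined (cap v))"
    using card_mono card_image[OF inj] by metis
  then show ?thesis
    using card_A[OF assms] by simp
qed

lemma lattice_perm_incidence: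
  assumes \<pi>: "lattice_perm d verts \<pi>"
  shows "\<exists>q r. bij_betw q E E \<and> bij_betw r V V \<and> (\<forall>x\<in>E. \<pi> (e x) = e (q x)) \<and> (\<forall>v\<in>V. \<pi> (cap v) = cap (r v)) \<and>
    (\<forall>x\<in>E. \<forall>v\<in>V. q x \<in> A (r v) \<longleftrightarrow> x \<in> A v)"
proof -
  have bij: "bij_betw \<pi> verts verts" and surj: "\<pi> ` verts = verts" and inj: "inj_on \<pi> verts"
    using \<pi> by (auto simp: lattice_perm_def bij_betw_def)
  have \<pi>_in: "\<pi> s \<in> verts" if "s \<in> verts" for s
    using imageI[OF that, of \<pi>] by (simp add: surj)
  have \<pi>_joined: "joined (\<pi> s) (\<pi> t) \<longleftrightarrow> joined s t" if "s \<in> verts" "t \<in> verts" for s t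
  proof -
    have "(\<exists>F\<in>faces d (conv_fin verts). F \<inter> verts = {s, t}) \<longleftrightarrow> (\<exists>F\<in>faces d (conv_fin verts). F \<inter> verts = \<pi> ` {s, t})"
      using \<pi> that unfolding lattice_perm_def by (elim conjE allE[of _ "{s, t}"]) simp
    then show ?thesis
      by (simp add: joined_def)
  qed
  \<comment> \<open>The number of non-neighbours is invariant, and at most 3 against at least 4
    separates frame vectors from caps.\<close>
  have card_nj: "card (nonjoined (\<pi> s)) = card (nonjoined s)" if s: "s \<in> verts" for s
  proof -
    have "nonjoined (\<pi> s) = \<pi> ` nonjoined s"
    proof (intro equalityI subsetI)
      fix t assume t: "t \<in> nonjoined (\<pi> s)"
      then have "t \<in> \<pi> ` verts"
        by (simp add: surj nonjoined_def)
      then obtain u where "u \<in> verts" "t = \<pi> u"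
        by blast
      then show "t \<in> \<pi> ` nonjoined s"
        using t \<pi>_joined[OF s] by (simp add: nonjoined_def)
    next
      fix t assume "t \<in> \<pi> ` nonjoined s"
      then obtain u where "u \<in> verts" "\<not> joined s u" "t = \<pi> u"
        unfolding nonjoined_def by blast
      then show "t \<in> nonjoined (\<pi> s)"
        using \<pi>_joined[OF s] \<pi>_in by (simp add: nonjoined_def)
    qed
    moreover have "inj_on \<pi> (nonjoined s)"
      using inj by (rule inj_on_subset) (auto simp: nonjoined_def)
    ultimately show ?thesis
      by (simp add: card_image)
  qed
  have e_verts: "e x \<in> verts" if "x \<in> E" for x
    using that by (simp add: verts_def)
  have cap_verts: "cap v \<in> verts" if "v \<in> V" for v
    using that by (simp add: verts_def)
  have "\<exists>y\<in>E. \<pi> (e x) = e y" if x: "x \<in> E" for x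
  proof (rule ccontr)
    assume "\<not> ?thesis"
    then obtain v where "v \<in> V" "\<pi> (e x) = cap v"
      using \<pi>_in[OF e_verts[OF x]] unfolding verts_def by blast
    then show False
      using card_nj[OF e_verts[OF x]] card_nonjoined_cap[of v] card_nonjoined_e[OF x] by simp
  qed
  then have "\<forall>x\<in>E. \<exists>y. y \<in> E \<and> \<pi> (e x) = e y"
    by (simp add: Bex_def)
  from bchoice[OF this] obtain q where "\<forall>x\<in>E. q x \<in> E \<and> \<pi> (e x) = e (q x)" ..
  then have q: "q x \<in> E \<and> \<pi> (e x) = e (q x)" if "x \<in> E" for x
    using that by (rule bspec)
  have "\<exists>w\<in>V. \<pi> (cap v) = cap w" if v: "v \<in> V" for v
  proof (rule ccontr)
    assume "\<not> ?thesis"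
    then obtain y where "y \<in> E" "\<pi> (cap v) = e y"
      using \<pi>_in[OF cap_verts[OF v]] unfolding verts_def by blast
    then show False
      using card_nj[OF cap_verts[OF v]] card_nonjoined_e[of y] card_nonjoined_cap[OF v] by simp
  qed
  then have "\<forall>v\<in>V. \<exists>w. w \<in> V \<and> \<pi> (cap v) = cap w"
    by (simp add: Bex_def)
  from bchoice[OF this] obtain r where "\<forall>v\<in>V. r v \<in> V \<and> \<pi> (cap v) = cap (r v)" ..
  then have r: "r v \<in> V \<and> \<pi> (cap v) = cap (r v)" if "v \<in> V" for v
    using that by (rule bspec)
  have "inj_on q E"
  proof (rule inj_onI)
    fix x y assume xy: "x \<in> E" "y \<in> E" "q x = q y"
    have "\<pi> (e x) = \<pi> (e y)"
      using q[OF xy(1)] q[OF xy(2)] xy(3) by simp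
    then have "e x = e y"
      by (rule inj_onD[OF inj _ e_verts[OF xy(1)] e_verts[OF xy(2)]])
    then show "x = y"
      using xy(1,2) by (rule inj_onD[OF e_inj])
  qed
  then have q_bij: "bij_betw q E E"
    using endo_inj_surj[OF finite_E] q by (simp add: bij_betw_def image_subset_iff)
  have "inj_on r V"
  proof (rule inj_onI)
    fix v w assume vw: "v \<in> V" "w \<in> V" "r v = r w"
    have "\<pi> (cap v) = \<pi> (cap w)"
      using r[OF vw(1)] r[OF vw(2)] vw(3) by simp
    then have "cap v = cap w"
      by (rule inj_onD[OF inj _ cap_verts[OF vw(1)] cap_verts[OF vw(2)]])
    then show "v = w"
      using vw(1,2) by (rule inj_onD[OF cap_inj])
  qed
  then have r_bij: "bij_betw r V V"
    using endo_inj_surj[OF finite_V] r by (simp add: bij_betw_def image_subset_iff)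
  have q_\<tau>: "q (\<tau> x) = \<tau> (q x)" if x: "x \<in> E" for x
  proof -
    note \<tau>x = \<tau>_in[OF x]
    \<comment> \<open>By \<open>joined_e_e\<close> the antipode is the only frame vector not joined
      to \<open>e (q x)\<close>.\<close>
    have "\<not> joined (e (q x)) (e (q (\<tau> x)))"
      using \<pi>_joined[OF e_verts[OF x] e_verts[OF \<tau>x]] q[OF x] q[OF \<tau>x] joined_e_e_iff[OF x \<tau>x] by simp
    then show ?thesis
      using joined_e_e q[OF x] q[OF \<tau>x] by blast
  qed
  have "q x \<in> A (r v) \<longleftrightarrow> x \<in> A v" if x: "x \<in> E" and v: "v \<in> V" for x v
  proof -
    note \<tau>x = \<tau>_in[OF x]
    \<comment> \<open>Incidence of \<open>x\<close> with \<open>v\<close> is visible at the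
      antipode: \<open>cap v\<close> misses \<open>e (\<tau> x)\<close> exactly when
      \<open>x \<in> A v\<close>.\<close>
    have "joined (cap (r v)) (e (q (\<tau> x))) \<longleftrightarrow> joined (cap v) (e (\<tau> x))"
      using \<pi>_joined[OF cap_verts[OF v] e_verts[OF \<tau>x]] q[OF \<tau>x] r[OF v] by simp
    moreover have "\<tau> (q (\<tau> x)) = q x"
      using q_\<tau>[OF \<tau>x] \<tau>_\<tau>[OF x] by simp
    ultimately show ?thesis
      using joined_cap_e_iff[OF v \<tau>x] joined_cap_e_iff[of "r v" "q (\<tau> x)"] r[OF v] q[OF \<tau>x] \<tau>_\<tau>[OF x] by simp
  qed
  then show ?thesis
    using q r q_bij r_bij by (intro exI[of _ q] exI[of _ r] conjI ballI) simp_all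
qed

end

section \<open>From an action on edges and vertices to a polytope\<close>

lemma ip_cap_e:
  assumes v: "v \<in> V" and x: "x \<in> E"
  shows "ip d (cap v) (e x) = ((if x \<in> A v then 1 else 0) - (if \<tau> x \<in> A v then 1 else 0)) / (real (card (A v)) - 1)"
proof -
  have "(\<Sum>y\<in>A v. ip d (e x) (e y)) = (\<Sum>y\<in>A v. (if x = y then 1 else 0) - (if \<tau> x = y then 1 else 0))"
  proof (intro sum.cong refl)
    fix y assume "y \<in> A v"
    then have y: "y \<in> E"
      using A_subset[OF v] by blast
    then have "x = \<tau> y \<longleftrightarrow> \<tau> x = y"
      using \<tau>_\<tau> x by metis
    then show "ip d (e x) (e y) = (if x = y then 1 else 0) - (if \<tau> x = y then 1 else 0)"
      using x y \<tau>_neq by (auto simp: ip_e)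
  qed
  also have "\<dots> = (if x \<in> A v then 1 else 0) - (if \<tau> x \<in> A v then 1 else 0)"
    using finite_A[OF v] by (simp add: sum_subtractf)
  finally show ?thesis
    by (simp add: ip_commute[of d "cap v"] ip_cap)
qed

text \<open>The normalizing factor of a cap depends on the size of its star, so the proof also needs
  that \<open>q\<close> maps \<open>A v\<close> onto \<open>A w\<close>.\<close>

lemma perm_map_cap:
  assumes q: "bij_betw q E E" "\<And>x. x \<in> E \<Longrightarrow> q (\<tau> x) = \<tau> (q x)" and v: "v \<in> V" "w \<in> V"
    and inc: "\<And>x. x \<in> E \<Longrightarrow> q x \<in> A w \<longleftrightarrow> x \<in> A v"
  shows "perm_map q (cap v) = cap w"
proof (rule Ed_eqI)
  fix y assume "y \<in> E"
  then obtain x where x: "x \<in> E" "y = q x"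
    using bij_betw_imp_surj_on[OF q(1)] by blast
  have "q ` A v = A w"
  proof (intro equalityI subsetI)
    fix z assume z: "z \<in> A w"
    then obtain u where "u \<in> E" "z = q u"
      using A_subset[OF v(2)] bij_betw_imp_surj_on[OF q(1)] by blast
    then show "z \<in> q ` A v"
      using z inc by blast
  qed (use inc A_subset[OF v(1)] in blast)
  then have "card (A w) = card (A v)"
    using card_image[OF inj_on_subset[OF bij_betw_imp_inj_on[OF q(1)] A_subset[OF v(1)]]] by simp
  moreover have "\<tau> (q x) \<in> A w \<longleftrightarrow> \<tau> x \<in> A v"
    using inc[OF \<tau>_in[OF x(1)]] q(2)[OF x(1)] by simp
  ultimately show "ip d (perm_map q (cap v)) (e y) = ip d (cap w) (e y)"
    using x ip_perm_map[OF q cap_in[OF v(1)] x(1)] perm_in[OF q x(1)] inc[OF x(1)] v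
    by (simp add: ip_cap_e)
qed (use perm_map_in[OF q] cap_in v in auto)

text \<open>The hypothesis \<open>perm\<close> carries the rigidity. The others say that
  \<open>G\<close> acts compatibly on both kinds of vertices with \<open>\<sigma>\<close> acting as
  \<open>\<tau>\<close>, which is what \<open>perm_map\<close> turns into symmetries.\<close>

lemma group_realization:
  fixes G (structure)
  assumes grp: "group G" and act_in: "\<And>a x. a \<in> carrier G \<Longrightarrow> x \<in> E \<Longrightarrow> act a x \<in> E"
    and act_mult: "\<And>a b x. a \<in> carrier G \<Longrightarrow> b \<in> carrier G \<Longrightarrow> x \<in> E \<Longrightarrow> act (a \<otimes> b) x = act a (act b x)"
    and act_one: "\<And>x. x \<in> E \<Longrightarrow> act \<one> x = x"
    and faithful: "\<And>a b. a \<in> carrier G \<Longrightarrow> b \<in> carrier G \<Longrightarrow> \<forall>x\<in>E. act a x = act b x \<Longrightarrow> a = b"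
    and \<sigma>: "\<sigma> \<in> carrier G" "\<And>x. x \<in> E \<Longrightarrow> act \<sigma> x = \<tau> x"
    and act_\<tau>: "\<And>a x. a \<in> carrier G \<Longrightarrow> x \<in> E \<Longrightarrow> act a (\<tau> x) = \<tau> (act a x)"
    and actV: "\<And>a v. a \<in> carrier G \<Longrightarrow> v \<in> V \<Longrightarrow> actV a v \<in> V"
    and inc: "\<And>a v x. a \<in> carrier G \<Longrightarrow> v \<in> V \<Longrightarrow> x \<in> E \<Longrightarrow> act a x \<in> A (actV a v) \<longleftrightarrow> x \<in> A v"
    and perm: "\<And>\<pi>. lattice_perm d verts \<pi> \<Longrightarrow>
      \<exists>a\<in>carrier G. (\<forall>x\<in>E. \<pi> (e x) = e (act a x)) \<and> (\<forall>v\<in>V. \<pi> (cap v) = cap (actV a v))"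
  shows "\<exists>P. realizes_centrally G \<sigma> d P"
proof -
  interpret group G by (rule grp)
  let ?P = "conv_fin verts"
  define \<phi> where "\<phi> a = perm_map (act a)" for a
  have act_bij: "bij_betw (act a) E E" if "a \<in> carrier G" for a
    by (rule bij_betw_byWitness[of _ "act (inv a)"])
      (use that act_in act_mult[symmetric] act_one in auto)
  note act = act_bij act_\<tau>
  have \<phi>_e: "\<phi> a (e x) = e (act a x)" if "a \<in> carrier G" "x \<in> E" for a x
    unfolding \<phi>_def using that by (intro perm_map_e act)
  have \<phi>_cap: "\<phi> a (cap v) = cap (actV a v)" if "a \<in> carrier G" "v \<in> V" for a v
    unfolding \<phi>_def using that by (intro perm_map_cap act actV inc)
  have \<phi>_sym: "\<phi> a \<in> symmetries d ?P" if a: "a \<in> carrier G" for a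
    unfolding \<phi>_def
  proof (rule perm_map_symmetry[OF act[OF a] finite_verts verts_in])
    show "perm_map (act a) ` verts = verts"
    proof (rule endo_inj_surj[OF finite_verts])
      show "perm_map (act a) ` verts \<subseteq> verts"
        using \<phi>_e[OF a] \<phi>_cap[OF a] act_in[OF a] actV[OF a] by (auto simp: verts_def \<phi>_def)
      show "inj_on (perm_map (act a)) verts"
        by (rule inj_on_subset[OF perm_map_inj[OF act[OF a]] verts_in])
    qed
  qed
  have \<phi>_inj: "inj_on \<phi> (carrier G)"
  proof (rule inj_onI)
    fix a b assume ab: "a \<in> carrier G" "b \<in> carrier G" "\<phi> a = \<phi> b"
    have "act a x = act b x" if "x \<in> E" for x
      using \<phi>_e[OF ab(1) that] \<phi>_e[OF ab(2) that] ab act_in that inj_onD[OF e_inj] by metis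
    then show "a = b"
      using faithful ab by blast
  qed
  have \<phi>_mult: "\<phi> (a \<otimes> b) = compose (Ed d) (\<phi> a) (\<phi> b)" if "a \<in> carrier G" "b \<in> carrier G" for a b
    unfolding \<phi>_def using that by (intro perm_map_compose act act_mult)
  have \<phi>_\<sigma>: "\<phi> \<sigma> = restrict central_sym (Ed d)"
    unfolding \<phi>_def by (rule perm_map_\<tau>) (rule \<sigma>(2))
  have perm': "\<exists>a\<in>carrier G. \<forall>s\<in>verts. \<phi> a s = \<pi> s" if \<pi>: "lattice_perm d verts \<pi>" for \<pi>
  proof -
    obtain a where a: "a \<in> carrier G" "\<forall>x\<in>E. \<pi> (e x) = e (act a x)" "\<forall>v\<in>V. \<pi> (cap v) = cap (actV a v)"
      using perm[OF \<pi>] by blast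
    have "\<phi> a s = \<pi> s" if "s \<in> verts" for s
      using that a \<phi>_e[OF a(1)] \<phi>_cap[OF a(1)] by (auto simp: verts_def)
    then show ?thesis
      using a(1) by blast
  qed
  have solid: "solid d ?P"
    by (rule solid_if_frame_subset[OF finite_verts]) (simp add: verts_def)
  \<comment> \<open>Central symmetry of the polytope comes for free: negation is the symmetry
    belonging to \<open>\<sigma>\<close>.\<close>
  have "central_sym ` ?P = \<phi> \<sigma> ` ?P"
    using conv_fin_in_Ed[OF verts_in] by (intro image_cong) (auto simp: \<phi>_\<sigma>)
  then have "central_sym ` ?P = ?P"
    using \<phi>_sym[OF \<sigma>(1)] by (simp add: symmetries_def)
  moreover have "is_polytope d ?P"
    using finite_verts verts_in solid unfolding is_polytope_def solid_def by blast
  moreover note realization[OF finite_verts verts_in solid exposed_vertex \<phi>_sym \<phi>_inj perm']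
  ultimately show ?thesis
    using \<phi>_mult \<phi>_\<sigma> unfolding realizes_centrally_def by (intro exI[of _ ?P] exI[of _ \<phi>] conjI ballI)
qed

end

section \<open>Graphs with prescribed automorphism group\<close>

lemma (in signed_frame) cap_config_no_caps: "cap_config E \<tau> d e {} A"
  by unfold_locales auto

text \<open>\<open>E\<close> lists each undirected edge once, in an orientation preserved by the
  action. Thus \<open>card (A v)\<close> is the degree of \<open>v\<close>, and
  \<open>\<sigma>\<close> cannot fix an edge by swapping its ends. In \<open>rigid\<close>, the
  bijections considered are those that a lattice automorphism induces on the caps.\<close>

lemma graph_realization:
  fixes G (structure) and V :: "'v set" and E :: "('v \<times> 'v) set"
  defines "A \<equiv> \<lambda>v. {x\<in>E. fst x = v \<or> snd x = v}" and "adj \<equiv> \<lambda>u w. (u, w) \<in> E \<or> (w, u) \<in> E"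
  assumes grp: "group G" and V: "finite V" "V \<noteq> {}" and E: "E \<subseteq> V \<times> V" "\<And>u w. (u, w) \<in> E \<Longrightarrow> (w, u) \<notin> E"
    and deg: "\<And>v. v \<in> V \<Longrightarrow> 4 \<le> card (A v)"
    and act_in: "\<And>a v. a \<in> carrier G \<Longrightarrow> v \<in> V \<Longrightarrow> act a v \<in> V"
    and act_mult: "\<And>a b v. a \<in> carrier G \<Longrightarrow> b \<in> carrier G \<Longrightarrow> v \<in> V \<Longrightarrow> act (a \<otimes> b) v = act a (act b v)"
    and act_one: "\<And>v. v \<in> V \<Longrightarrow> act \<one> v = v"
    and act_E: "\<And>a u w. a \<in> carrier G \<Longrightarrow> (u, w) \<in> E \<Longrightarrow> (act a u, act a w) \<in> E"
    and free: "\<And>a b v. a \<in> carrier G \<Longrightarrow> b \<in> carrier G \<Longrightarrow> v \<in> V \<Longrightarrow> act a v = act b v \<Longrightarrow> a = b"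
    and \<sigma>: "\<sigma> \<in> carrier G" "\<sigma> \<noteq> \<one>" "\<sigma> \<otimes> \<sigma> = \<one>" "\<And>a. a \<in> carrier G \<Longrightarrow> a \<otimes> \<sigma> = \<sigma> \<otimes> a"
    and \<sigma>_nonadj: "\<And>u w. (u, w) \<in> E \<Longrightarrow> w \<noteq> act \<sigma> u"
    and rigid: "\<And>r. bij_betw r V V \<Longrightarrow> (\<And>v. v \<in> V \<Longrightarrow> card (A (r v)) = card (A v)) \<Longrightarrow>
      (\<And>u w. u \<in> V \<Longrightarrow> w \<in> V \<Longrightarrow> adj (r u) (r w) \<longleftrightarrow> adj u w) \<Longrightarrow> \<exists>a\<in>carrier G. \<forall>v\<in>V. r v = act a v"
  shows "\<exists>d>0. \<exists>P. realizes_centrally G \<sigma> d P"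
proof -
  interpret group G by (rule grp)
  define act2 where "act2 a x = (act a (fst x), act a (snd x))" for a x
  have E_V: "fst x \<in> V" "snd x \<in> V" if "x \<in> E" for x
    using that E(1) by auto
  have fin_E: "finite E"
    using E(1) V(1) by (meson finite_SigmaI finite_subset)
  have E_ne: "E \<noteq> {}"
    using V(2) deg by (fastforce simp: A_def)
  have act2_in: "act2 a x \<in> E" if "a \<in> carrier G" "x \<in> E" for a x
    using act_E[OF that(1), of "fst x" "snd x"] that(2) by (simp add: act2_def)
  have act2_mult: "act2 (a \<otimes> b) x = act2 a (act2 b x)" if "a \<in> carrier G" "b \<in> carrier G" "x \<in> E" for a b x
    using that E_V by (simp add: act2_def act_mult)
  have act2_one: "act2 \<one> x = x" if "x \<in> E" for x
    using that E_V by (simp add: act2_def act_one)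
  have \<sigma>_\<sigma>: "act \<sigma> (act \<sigma> v) = v" if "v \<in> V" for v
    using act_mult[OF \<sigma>(1,1) that] \<sigma>(3) act_one[OF that] by simp
  have \<sigma>_neq: "act \<sigma> v \<noteq> v" if "v \<in> V" for v
    using free[OF \<sigma>(1) one_closed that] \<sigma>(2) act_one[OF that] by auto
  have "\<exists>d e. d > 0 \<and> signed_frame E (act2 \<sigma>) d e"
  proof (rule signed_frame_exists[OF fin_E E_ne])
    fix x assume x: "x \<in> E"
    show "act2 \<sigma> (act2 \<sigma> x) = x"
      using \<sigma>_\<sigma> E_V[OF x] by (simp add: act2_def)
    show "act2 \<sigma> x \<noteq> x"
      using \<sigma>_neq[OF E_V(1)[OF x]] by (metis act2_def fst_conv)
  qed (rule act2_in[OF \<sigma>(1)])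
  then obtain d e where d: "d > 0" and frame: "signed_frame E (act2 \<sigma>) d e"
    by blast
  interpret signed_frame E "act2 \<sigma>" d e
    by (rule frame)
  have A_E: "A v \<subseteq> E" for v
    by (auto simp: A_def)
  have common_edge: "x = (u, w) \<or> x = (w, u)" if "x \<in> A u" "x \<in> A w" "u \<noteq> w" for x u w
    using that by (cases x) (auto simp: A_def)
  have A_unique: "x = y" if "x \<in> A u" "x \<in> A w" "y \<in> A u" "y \<in> A w" "u \<noteq> w" for x y u w
    using common_edge[OF that(1,2,5)] common_edge[OF that(3,4,5)] E(2) that A_E by blast
  interpret cap_config E "act2 \<sigma>" d e V A
  proof
    fix v x assume v: "v \<in> V" and x: "x \<in> A v"
    have xE: "(fst x, snd x) \<in> E" "fst x = v \<or> snd x = v"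
      using x by (auto simp: A_def)
    then have "fst x \<in> V" "snd x \<in> V" "snd x \<noteq> act \<sigma> (fst x)"
      using E(1) \<sigma>_nonadj by auto
    \<comment> \<open>\<open>\<sigma>\<close> sends an end of \<open>x\<close> neither to itself nor
      to the other end, so the image of \<open>x\<close> avoids \<open>v\<close>.\<close>
    then have "act \<sigma> (fst x) \<noteq> v" "act \<sigma> (snd x) \<noteq> v"
      using xE(2) \<sigma>_neq \<sigma>_\<sigma> by metis+
    then show "act2 \<sigma> x \<notin> A v"
      by (simp add: A_def act2_def)
  next
    fix v w assume "v \<in> V" "w \<in> V" "v \<noteq> w"
    then have "\<forall>x\<in>A v \<inter> A w. \<forall>y\<in>A v \<inter> A w. x = y"
      using A_unique by blast
    then show "card (A v \<inter> A w) \<le> 1"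
      using finite_subset[OF A_E fin_E] by (simp add: card_le_Suc0_iff_eq)
  next
    fix x assume "x \<in> E"
    have "{v\<in>V. x \<in> A v} \<subseteq> {fst x, snd x}"
      by (auto simp: A_def)
    then have "card {v\<in>V. x \<in> A v} \<le> card {fst x, snd x}"
      by (intro card_mono) auto
    also have "\<dots> \<le> 2"
      by (simp add: card_insert_if)
    finally show "card {v\<in>V. x \<in> A v} \<le> 2" .
  qed (use V A_E deg in auto)
  have act_inj: "act a u = act a w \<longleftrightarrow> u = w" if "a \<in> carrier G" "u \<in> V" "w \<in> V" for a u w
  proof
    assume "act a u = act a w"
    then have "act (inv a) (act a u) = act (inv a) (act a w)"
      by simp
    then show "u = w"
      using that by (simp add: act_one flip: act_mult)
  qed simp
  have "\<exists>a\<in>carrier G. (\<forall>x\<in>E. \<pi> (e x) = e (act2 a x)) \<and> (\<forall>v\<in>V. \<pi> (cap v) = cap (act a v))"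
    if \<pi>: "lattice_perm d verts \<pi>" for \<pi>
  proof -
    obtain q r where q: "bij_betw q E E" and r: "bij_betw r V V" and \<pi>_e: "\<forall>x\<in>E. \<pi> (e x) = e (q x)"
      and \<pi>_cap: "\<forall>v\<in>V. \<pi> (cap v) = cap (r v)" and qr: "\<forall>x\<in>E. \<forall>v\<in>V. q x \<in> A (r v) \<longleftrightarrow> x \<in> A v"
      using lattice_perm_incidence[OF V(2) \<pi>] by blast
    have r_in: "r v \<in> V" if "v \<in> V" for v
      using bij_betwE[OF r] that by blast
    have q_onto: "\<exists>x\<in>E. y = q x" if "y \<in> E" for y
    proof -
      have "y \<in> q ` E"
        using bij_betw_imp_surj_on[OF q] that by simp
      then show ?thesis
        by blast
    qed
    have card_r: "card (A (r v)) = card (A v)" if v: "v \<in> V" for v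
    proof -
      have "A (r v) = q ` A v"
      proof (intro equalityI subsetI)
        fix y assume y: "y \<in> A (r v)"
        then obtain x where "x \<in> E" "y = q x"
          using q_onto A_E by blast
        then show "y \<in> q ` A v"
          using qr v y by simp
      next
        fix y assume "y \<in> q ` A v"
        then obtain x where "x \<in> A v" "y = q x"
          by blast
        then show "y \<in> A (r v)"
          using qr v A_E[of v] by auto
      qed
      then show ?thesis
        using card_image[OF inj_on_subset[OF bij_betw_imp_inj_on[OF q] A_E[of v]]] by simp
    qed
    \<comment> \<open>Adjacency rephrased as having a common edge, the form in which
      \<open>q\<close> and \<open>r\<close> jointly preserve it.\<close>
    have adj_iff: "adj u w \<longleftrightarrow> (\<exists>x\<in>E. x \<in> A u \<and> x \<in> A w)" if uw: "u \<noteq> w" for u w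
    proof
      assume "adj u w"
      then show "\<exists>x\<in>E. x \<in> A u \<and> x \<in> A w"
        by (force simp: adj_def A_def)
    next
      assume "\<exists>x\<in>E. x \<in> A u \<and> x \<in> A w"
      then obtain x where "x \<in> E" "x = (u, w) \<or> x = (w, u)"
        using common_edge[OF _ _ uw] by blast
      then show "adj u w"
        by (auto simp: adj_def)
    qed
    have adj_r: "adj (r u) (r w) \<longleftrightarrow> adj u w" if uw: "u \<in> V" "w \<in> V" for u w
    proof (cases "u = w")
      case True
      then show ?thesis
        using E(2) by (auto simp: adj_def)
    next
      case False
      then have "r u \<noteq> r w"
        using inj_on_eq_iff[OF bij_betw_imp_inj_on[OF r]] uw by simp
      then show ?thesis
        unfolding adj_iff[OF False] adj_iff[OF \<open>r u \<noteq> r w\<close>]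
        by (subst bij_betw_imp_surj_on[OF q, symmetric]) (use qr uw in simp)
    qed
    have "\<exists>a\<in>carrier G. \<forall>v\<in>V. r v = act a v"
      by (rule rigid[OF r card_r adj_r])
    then obtain a where a: "a \<in> carrier G" "\<forall>v\<in>V. r v = act a v"
      by blast
    \<comment> \<open>Both edges have the ends \<open>r (fst x)\<close> and
      \<open>r (snd x)\<close>, and an edge is determined by its ends.\<close>
    have "q x = act2 a x" if x: "x \<in> E" for x
    proof (rule A_unique)
      have ends: "x \<in> A (fst x)" "x \<in> A (snd x)"
        using x by (auto simp: A_def)
      show "q x \<in> A (r (fst x))" "q x \<in> A (r (snd x))"
        using qr x E_V[OF x] ends by auto
      show "act2 a x \<in> A (r (fst x))" "act2 a x \<in> A (r (snd x))"
        using act2_in[OF a(1) x] a(2) E_V[OF x] by (auto simp: A_def act2_def)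
      have "fst x \<noteq> snd x"
        using E(2)[of "fst x" "snd x"] x by (cases x) auto
      then show "r (fst x) \<noteq> r (snd x)"
        using inj_on_eq_iff[OF bij_betw_imp_inj_on[OF r]] E_V[OF x] by simp
    qed
    then show ?thesis
      using a \<pi>_e \<pi>_cap by (intro bexI[of _ a] conjI ballI) simp_all
  qed
  moreover have "act2 a (act2 \<sigma> x) = act2 \<sigma> (act2 a x)" if "a \<in> carrier G" "x \<in> E" for a x
    using that \<sigma>(1) \<sigma>(4)[OF that(1)] by (simp flip: act2_mult)
  moreover have "a = b" if "a \<in> carrier G" "b \<in> carrier G" "\<forall>x\<in>E. act2 a x = act2 b x" for a b
  proof -
    obtain x where x: "x \<in> E"
      using E_ne by blast
    then have "act a (fst x) = act b (fst x)"
      using that(3) by (auto simp: act2_def)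
    then show ?thesis
      using free[OF that(1,2) E_V(1)[OF x]] by blast
  qed
  moreover have "act2 a x \<in> A (act a v) \<longleftrightarrow> x \<in> A v" if "a \<in> carrier G" "v \<in> V" "x \<in> E" for a v x
    using act2_in[OF that(1,3)] that E_V[OF that(3)] by (auto simp: A_def act2_def act_inj)
  ultimately have "\<exists>P. realizes_centrally G \<sigma> d P"
    using act2_in act2_mult act2_one act_in \<sigma>(1)
    by (intro group_realization[OF grp, where act = act2 and actV = act]) auto
  then show ?thesis
    using d by blast
qed

text \<open>The frame is indexed by the group itself: one axis with its two ends and no caps. Both
  permutations of the two ends are translations by group elements.\<close>

lemma order_two_realization:
  fixes G (structure)
  assumes grp: "group G" and carrier: "carrier G = {\<one>, \<sigma>}" and \<sigma>: "\<sigma> \<noteq> \<one>" "\<sigma> \<otimes> \<sigma> = \<one>"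
  shows "\<exists>d>0. \<exists>P. realizes_centrally G \<sigma> d P"
proof -
  interpret group G by (rule grp)
  have \<sigma>_in: "\<sigma> \<in> carrier G"
    by (simp add: carrier)
  have "\<exists>d e. d > 0 \<and> signed_frame (carrier G) ((\<otimes>) \<sigma>) d e"
    by (rule signed_frame_exists) (use carrier \<sigma> \<sigma>_in in auto)
  then obtain d e where d: "d > 0" and frame: "signed_frame (carrier G) ((\<otimes>) \<sigma>) d e"
    by blast
  interpret signed_frame "carrier G" "(\<otimes>) \<sigma>" d e
    by (rule frame)
  interpret cap_config "carrier G" "(\<otimes>) \<sigma>" d e "{} :: 'a set" "\<lambda>_. {}"
    by (rule cap_config_no_caps)
  have e_neq: "e \<one> \<noteq> e \<sigma>"
    using inj_on_eq_iff[OF e_inj, of \<one> \<sigma>] \<sigma>(1) \<sigma>_in by auto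
  have verts: "verts = {e \<one>, e \<sigma>}"
    unfolding verts_def by (simp add: carrier)
  have perm: "\<exists>a\<in>carrier G. (\<forall>x\<in>carrier G. \<pi> (e x) = e (a \<otimes> x)) \<and> (\<forall>v\<in>{}. \<pi> (cap v) = cap v)"
    if \<pi>: "lattice_perm d verts \<pi>" for \<pi>
  proof -
    have "\<pi> ` {e \<one>, e \<sigma>} = {e \<one>, e \<sigma>}"
      using \<pi> by (simp add: lattice_perm_def bij_betw_def verts)
    then have "\<pi> (e \<one>) = e \<one> \<and> \<pi> (e \<sigma>) = e \<sigma> \<or> \<pi> (e \<one>) = e \<sigma> \<and> \<pi> (e \<sigma>) = e \<one>"
      using e_neq by (auto simp: doubleton_eq_iff)
    then show ?thesis
    proof
      assume "\<pi> (e \<one>) = e \<one> \<and> \<pi> (e \<sigma>) = e \<sigma>"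
      then show ?thesis
        using \<sigma>_in by (intro bexI[of _ \<one>]) (auto simp: carrier)
    next
      assume "\<pi> (e \<one>) = e \<sigma> \<and> \<pi> (e \<sigma>) = e \<one>"
      then show ?thesis
        using \<sigma>_in \<sigma>(2) by (intro bexI[of _ \<sigma>]) (auto simp: carrier)
    qed
  qed
  have "\<exists>P. realizes_centrally G \<sigma> d P"
  proof (rule group_realization[OF grp, where act = "(\<otimes>)" and actV = "\<lambda>_ v. v"])
    show "a \<otimes> (\<sigma> \<otimes> x) = \<sigma> \<otimes> (a \<otimes> x)" if "a \<in> carrier G" "x \<in> carrier G" for a x
      using that \<sigma> \<sigma>_in by (auto simp: carrier)
    show "a = b" if "a \<in> carrier G" "b \<in> carrier G" "\<forall>x\<in>carrier G. a \<otimes> x = b \<otimes> x" for a b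
      using that by auto
    show "\<exists>a\<in>carrier G. (\<forall>x\<in>carrier G. \<pi> (e x) = e (a \<otimes> x)) \<and> (\<forall>v\<in>{}. \<pi> (cap v) = cap v)"
      if "lattice_perm d verts \<pi>" for \<pi>
      using perm[OF that] .
  qed (use \<sigma>_in in \<open>auto simp: m_assoc\<close>)
  then show ?thesis
    using d by blast
qed

section \<open>A layered graph with prescribed automorphism group\<close>

locale ranked_group = group G for G (structure) +
  fixes M :: nat and rk :: "'a \<Rightarrow> nat"
  assumes rk: "bij_betw rk (carrier G) {..<M}" and M: "4 \<le> M"
begin

text \<open>Layer \<open>0\<close> sees the position of \<open>inv g \<otimes> h\<close> in the enumeration \<open>rk\<close> through the layers joined to it;
  consecutive layers \<open>j \<ge> 1\<close> are tied together by the complement of a perfect matching. The sizes are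
  chosen so that distinct layers have distinct degrees.\<close>

definition edges :: "(('a \<times> nat) \<times> ('a \<times> nat)) set" where
  "edges = {((g, i), (h, j)) | g h i j. g \<in> carrier G \<and> h \<in> carrier G \<and> j \<le> M \<and>
     (i = 0 \<and> rk (inv g \<otimes> h) < j \<or> 1 \<le> i \<and> j = Suc i \<and> g \<noteq> h)}"

definition nodes :: "('a \<times> nat) set" where
  "nodes = carrier G \<times> {..M}"

definition star :: "'a \<times> nat \<Rightarrow> (('a \<times> nat) \<times> ('a \<times> nat)) set" where
  "star v = {x\<in>edges. fst x = v \<or> snd x = v}"

definition adj :: "'a \<times> nat \<Rightarrow> 'a \<times> nat \<Rightarrow> bool" where
  "adj u w \<longleftrightarrow> (u, w) \<in> edges \<or> (w, u) \<in> edges"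

text \<open>For \<open>j \<ge> 1\<close> a node has \<open>j\<close> neighbours in layer 0, since
  exactly \<open>j\<close> group elements have rank below \<open>j\<close>, and \<open>M - 1\<close>
  in each adjacent layer that is not layer 0. The values are \<open>M\<close> for layer 1,
  \<open>2 * M\<close> up to \<open>3 * M - 3\<close> for layers 2 to \<open>M - 1\<close>, and
  \<open>2 * M - 1\<close> for layer \<open>M\<close>.\<close>

definition layer_degree :: "nat \<Rightarrow> nat" where
  "layer_degree j = (if j = 0 then \<Sum>{1..M} else j + (if 2 \<le> j then M - 1 else 0) + (if j < M then M - 1 else 0))"

lemma finite_carrier: "finite (carrier G)"
  using bij_betw_finite[OF rk] by simp

lemma card_carrier: "card (carrier G) = M"
  using bij_betw_same_card[OF rk] by simp

lemma rk_less: "g \<in> carrier G \<Longrightarrow> rk g < M"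
  using bij_betwE[OF rk] by blast

lemma rk_eq: "g \<in> carrier G \<Longrightarrow> h \<in> carrier G \<Longrightarrow> rk g = rk h \<longleftrightarrow> g = h"
  using inj_on_eq_iff[OF bij_betw_imp_inj_on[OF rk]] by simp

lemma card_rk_vimage:
  assumes f: "bij_betw f (carrier G) (carrier G)" and j: "j \<le> M"
  shows "card {h\<in>carrier G. rk (f h) < j} = j"
proof -
  have "bij_betw (rk \<circ> f) {h\<in>carrier G. rk (f h) < j} {..<j}"
    unfolding bij_betw_def
  proof
    have bij: "bij_betw (rk \<circ> f) (carrier G) {..<M}"
      by (rule bij_betw_trans[OF f rk])
    show "inj_on (rk \<circ> f) {h\<in>carrier G. rk (f h) < j}"
      using bij_betw_imp_inj_on[OF bij] by (rule inj_on_subset) auto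
    show "(rk \<circ> f) ` {h\<in>carrier G. rk (f h) < j} = {..<j}"
    proof (intro equalityI subsetI)
      fix i assume i: "i \<in> {..<j}"
      then have "i \<in> (rk \<circ> f) ` carrier G"
        using j bij_betw_imp_surj_on[OF bij] by auto
      then show "i \<in> (rk \<circ> f) ` {h\<in>carrier G. rk (f h) < j}"
        using i by auto
    qed auto
  qed
  then show ?thesis
    by (simp add: bij_betw_same_card)
qed

lemma bij_inv_mult: "g \<in> carrier G \<Longrightarrow> bij_betw (\<lambda>h. inv g \<otimes> h) (carrier G) (carrier G)"
  by (rule bij_betw_byWitness[of _ "\<lambda>h. g \<otimes> h"]) (auto simp flip: m_assoc)

lemma bij_inv_mult':
  assumes g: "g \<in> carrier G"
  shows "bij_betw (\<lambda>h. inv h \<otimes> g) (carrier G) (carrier G)"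
proof -
  have "g \<otimes> (inv g \<otimes> h) = h" if "h \<in> carrier G" for h
    using g that by (simp flip: m_assoc)
  then show ?thesis
    using g by (intro bij_betw_byWitness[of _ "\<lambda>h. g \<otimes> inv h"]) (auto simp: inv_mult_group m_assoc)
qed

lemma card_star:
  assumes g: "g \<in> carrier G" and j: "j \<le> M"
  shows "card (star (g, j)) = layer_degree j"
proof (cases "j = 0")
  case True
  let ?T = "Sigma {1..M} (\<lambda>j. {h\<in>carrier G. rk (inv g \<otimes> h) < j})"
  have "star (g, 0) = (\<lambda>(j, h). ((g, 0), (h, j))) ` ?T"
    using g by (auto simp: star_def edges_def image_iff)
  then have "card (star (g, 0)) = card ?T"
    by (simp add: card_image inj_on_def)
  also have "\<dots> = (\<Sum>j\<in>{1..M}. card {h\<in>carrier G. rk (inv g \<otimes> h) < j})"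
    using finite_carrier by (intro card_SigmaI) auto
  also have "\<dots> = \<Sum>{1..M}"
    using card_rk_vimage[OF bij_inv_mult[OF g]] by (intro sum.cong) auto
  finally show ?thesis
    using True by (simp add: layer_degree_def)
next
  case False
  define T0 where "T0 = (\<lambda>h. ((h, 0::nat), (g, j))) ` {h\<in>carrier G. rk (inv h \<otimes> g) < j}"
  define T1 where "T1 = (\<lambda>h. ((h, j - 1), (g, j))) ` (if 2 \<le> j then carrier G - {g} else {})"
  define T2 where "T2 = (\<lambda>h. ((g, j), (h, Suc j))) ` (if j < M then carrier G - {g} else {})"
  have "star (g, j) = T0 \<union> T1 \<union> T2"
    using g j False by (auto simp: star_def edges_def T0_def T1_def T2_def image_iff)
  moreover have "finite T0" "finite T1" "finite T2"
    using finite_carrier by (simp_all add: T0_def T1_def T2_def)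
  moreover have "T0 \<inter> T1 = {}" "(T0 \<union> T1) \<inter> T2 = {}"
    using False by (auto simp: T0_def T1_def T2_def split: if_splits)
  ultimately have "card (star (g, j)) = card T0 + card T1 + card T2"
    by (simp add: card_Un_disjoint)
  moreover have "card T0 = j"
    using card_rk_vimage[OF bij_inv_mult'[OF g] j] by (simp add: T0_def card_image inj_on_def)
  moreover have "card T1 = (if 2 \<le> j then M - 1 else 0)" "card T2 = (if j < M then M - 1 else 0)"
    using g finite_carrier by (simp_all add: T1_def T2_def card_image inj_on_def card_carrier)
  ultimately show ?thesis
    using False by (simp add: layer_degree_def)
qed

text \<open>\<open>3 * M - 3\<close> is the largest degree outside layer 0. Twice the difference of
  the two sides is \<open>(M - 1) * (M - 4)\<close>, hence the assumption
  \<open>4 \<le> M\<close>.\<close>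

lemma layer_degree_zero: "3 * M - 2 \<le> layer_degree 0"
proof -
  obtain k where "M = k + 4"
    using M by (metis add.commute le_iff_add)
  then have "2 * (3 * M - 2) \<le> M * (M + 1)"
    by (simp add: algebra_simps)
  moreover have "2 * \<Sum>{1..M} = M * (M + 1)"
    using gauss_sum_from_Suc_0[of M, where ?'a = nat] by simp
  ultimately show ?thesis
    by (simp add: layer_degree_def)
qed

lemma layer_degree_ge: "j \<le> M \<Longrightarrow> 4 \<le> layer_degree j"
  using M layer_degree_zero by (cases "j = 0") (auto simp: layer_degree_def)

lemma layer_degree_inj:
  assumes "i \<le> M" "j \<le> M" "layer_degree i = layer_degree j"
  shows "i = j"
proof -
  have pos: "layer_degree k < layer_degree 0" if "k \<le> M" "k \<noteq> 0" for k
    using that M layer_degree_zero by (auto simp: layer_degree_def)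
  show ?thesis
  proof (cases "i = 0 \<or> j = 0")
    case True
    then show ?thesis
      using pos assms by (metis less_irrefl)
  next
    case False
    then show ?thesis
      using assms M by (auto simp: layer_degree_def split: if_splits)
  qed
qed

lemma adj_zero_iff:
  assumes "g \<in> carrier G" "h \<in> carrier G" "1 \<le> j" "j \<le> M"
  shows "adj (g, 0) (h, j) \<longleftrightarrow> rk (inv g \<otimes> h) < j"
  using assms by (auto simp: adj_def edges_def)

lemma adj_Suc_iff:
  assumes "g \<in> carrier G" "h \<in> carrier G" "1 \<le> j" "Suc j \<le> M"
  shows "adj (g, j) (h, Suc j) \<longleftrightarrow> g \<noteq> h"
  using assms by (auto simp: adj_def edges_def)

lemma graph_rigid:
  assumes r: "bij_betw r nodes nodes" and deg: "\<And>v. v \<in> nodes \<Longrightarrow> card (star (r v)) = card (star v)"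
    and r_adj: "\<And>u w. u \<in> nodes \<Longrightarrow> w \<in> nodes \<Longrightarrow> adj (r u) (r w) \<longleftrightarrow> adj u w"
  shows "\<exists>a\<in>carrier G. \<forall>(g, i)\<in>nodes. r (g, i) = (a \<otimes> g, i)"
proof -
  define p where "p i g = fst (r (g, i))" for i g
  have p: "r (g, i) = (p i g, i)" "p i g \<in> carrier G" if "g \<in> carrier G" "i \<le> M" for g i
  proof -
    have gi: "(g, i) \<in> nodes"
      using that by (simp add: nodes_def)
    obtain h j where hj: "r (g, i) = (h, j)"
      by fastforce
    then have h: "h \<in> carrier G" "j \<le> M"
      using bij_betwE[OF r] gi by (fastforce simp: nodes_def)+
    have "layer_degree j = layer_degree i"
      using deg[OF gi] card_star[OF h] card_star[OF that] hj by simp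
    then have "j = i"
      by (rule layer_degree_inj[OF h(2) that(2)])
    then show "r (g, i) = (p i g, i)" "p i g \<in> carrier G"
      using hj h(1) by (simp_all add: p_def)
  qed
  have p_adj: "adj (p i g, i) (p j h, j) \<longleftrightarrow> adj (g, i) (h, j)"
    if "g \<in> carrier G" "h \<in> carrier G" "i \<le> M" "j \<le> M" for g h i j
    using r_adj[of "(g, i)" "(h, j)"] that p by (simp add: nodes_def)
  \<comment> \<open>The only node of layer \<open>Suc j\<close> not adjacent to
    \<open>(g, j)\<close> is \<open>(g, Suc j)\<close>, so all layers from 1 on are permuted
    alike.\<close>
  have tie: "p (Suc j) g = p j g" if "g \<in> carrier G" "1 \<le> j" "Suc j \<le> M" for g j
    using p_adj[of g g j "Suc j"] that p by (simp add: adj_Suc_iff)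
  have p_eq: "p (Suc j) g = p 1 g" if "g \<in> carrier G" "Suc j \<le> M" for g j
    using that(2) by (induction j) (use tie[OF that(1)] in auto)
  \<comment> \<open>The rank of \<open>inv g \<otimes> h\<close> is the number of layers
    \<open>j \<ge> 1\<close> for which \<open>(g, 0)\<close> and \<open>(h, j)\<close> are not
    adjacent, so it is preserved, and \<open>rk\<close> is injective.\<close>
  have transport: "inv (p 0 g) \<otimes> p 1 h = inv g \<otimes> h" if gh: "g \<in> carrier G" "h \<in> carrier G" for g h
  proof -
    have "rk (inv (p 0 g) \<otimes> p 1 h) < Suc j \<longleftrightarrow> rk (inv g \<otimes> h) < Suc j" if "Suc j \<le> M" for j
      using p_adj[OF gh, of 0 "Suc j"] p_eq[OF gh(2) that] that gh p M by (simp add: adj_zero_iff)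
    moreover have "rk (inv (p 0 g) \<otimes> p 1 h) < M" "rk (inv g \<otimes> h) < M"
      using gh p M by (auto intro!: rk_less)
    ultimately have "rk (inv (p 0 g) \<otimes> p 1 h) = rk (inv g \<otimes> h)"
      by (metis Suc_leI lessI less_antisym linorder_neqE_nat not_less_eq)
    then show ?thesis
      using gh p M by (subst (asm) rk_eq) auto
  qed
  \<comment> \<open>In \<open>transport\<close>, \<open>g = \<one>\<close> identifies
    \<open>p 1\<close> as left translation by \<open>a\<close>; then \<open>g = h\<close> does the
    same for \<open>p 0\<close>.\<close>
  define a where "a = p 0 \<one>"
  have a: "a \<in> carrier G"
    using p M by (simp add: a_def)
  have p1: "p 1 h = a \<otimes> h" if "h \<in> carrier G" for h
    using transport[OF one_closed that] that p(2)[of h 1] a M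
    by (simp add: a_def[symmetric]) (metis inv_closed inv_inv inv_solve_left)
  have p0: "p 0 g = a \<otimes> g" if "g \<in> carrier G" for g
  proof -
    have "inv (p 0 g) \<otimes> (a \<otimes> g) = \<one>"
      using transport[OF that that] p1[OF that] that by simp
    then show ?thesis
      using that a p(2)[of g 0] by (metis inv_equality inv_inv inv_closed m_closed le0)
  qed
  have "p i g = a \<otimes> g" if "g \<in> carrier G" "i \<le> M" for g i
    using that p0 p1 p_eq[of g "i - 1"] by (cases i) auto
  then show ?thesis
    using a p by (intro bexI[of _ a]) (auto simp: nodes_def)
qed

end

theorem theorem4:
  fixes \<Gamma> :: "('a, 'b) monoid_scheme" (structure) and \<sigma> :: 'a
  assumes "comm_group \<Gamma>" and "finite (carrier \<Gamma>)" and "even (order \<Gamma>)"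
    and "\<sigma> \<in> carrier \<Gamma>" and "\<sigma> \<noteq> \<one>" and "\<sigma> \<otimes> \<sigma> = \<one>"
  shows "\<exists>d::nat. d > 0 \<and> (\<exists>P. is_polytope d P \<and> central_sym ` P = P \<and>
           (\<exists>\<phi>. bij_betw \<phi> (carrier \<Gamma>) (symmetries d P) \<and>
                (\<forall>a\<in>carrier \<Gamma>. \<forall>b\<in>carrier \<Gamma>. \<phi> (a \<otimes> b) = compose (Ed d) (\<phi> a) (\<phi> b)) \<and>
                \<phi> \<sigma> = restrict central_sym (Ed d)) \<and>
           bij_betw (induced d P) (symmetries d P) (comb_auts d P))"
proof -
  interpret comm_group \<Gamma> by (rule assms(1))
  have "\<exists>d>0. \<exists>P. realizes_centrally \<Gamma> \<sigma> d P"
  proof (cases "order \<Gamma> < 4")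
    case True
    have "order \<Gamma> \<noteq> 0"
      using assms(2) one_closed by (auto simp: order_def)
    then have "card (carrier \<Gamma>) = 2"
      using True assms(3) by (auto simp: order_def elim!: evenE)
    moreover have "card {\<one>, \<sigma>} = 2"
      using assms(5) by simp
    ultimately have "carrier \<Gamma> = {\<one>, \<sigma>}"
      using card_subset_eq[OF assms(2), of "{\<one>, \<sigma>}"] assms(4) by auto
    then show ?thesis
      by (rule order_two_realization[OF is_group _ assms(5,6)])
  next
    case False
    obtain rk where rk: "bij_betw rk (carrier \<Gamma>) {..<order \<Gamma>}"
      using ex_bij_betw_finite_nat[OF assms(2)] by (auto simp: order_def atLeast0LessThan)
    interpret ranked_group \<Gamma> "order \<Gamma>" rk
      by unfold_locales (use rk False in auto)
    show ?thesis
    proof (rule graph_realization[OF is_group, where V = nodes and E = edges and act = "\<lambda>a (g, i). (a \<otimes> g, i)"],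
        fold star_def adj_def)
      show "finite nodes" "nodes \<noteq> {}"
        using assms(2) one_closed by (auto simp: nodes_def)
      show "edges \<subseteq> nodes \<times> nodes"
        by (auto simp: edges_def nodes_def)
      show "(w, u) \<notin> edges" if "(u, w) \<in> edges" for u w
        using that by (auto simp: edges_def)
      show "4 \<le> card (star v)" if "v \<in> nodes" for v
        using that card_star layer_degree_ge by (auto simp: nodes_def)
      show "((case u of (g, i) \<Rightarrow> (a \<otimes> g, i)), (case w of (g, i) \<Rightarrow> (a \<otimes> g, i))) \<in> edges"
        if a: "a \<in> carrier \<Gamma>" and uw: "(u, w) \<in> edges" for a u w
      proof -
        have "inv (a \<otimes> g) \<otimes> (a \<otimes> h) = inv g \<otimes> h" if "g \<in> carrier \<Gamma>" "h \<in> carrier \<Gamma>" for g h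
          using a that by (simp add: inv_mult_group m_assoc inv_solve_left')
        then show ?thesis
          using a uw by (auto simp: edges_def)
      qed
      \<comment> \<open>Translations keep the layer, whereas the ends of an edge lie in different
        layers.\<close>
      show "w \<noteq> (case u of (g, i) \<Rightarrow> (\<sigma> \<otimes> g, i))" if "(u, w) \<in> edges" for u w
        using that by (auto simp: edges_def)
      show "a = b" if "a \<in> carrier \<Gamma>" "b \<in> carrier \<Gamma>" "v \<in> nodes"
        "(case v of (g, i) \<Rightarrow> (a \<otimes> g, i)) = (case v of (g, i) \<Rightarrow> (b \<otimes> g, i))" for a b v
        using that by (auto simp: nodes_def)
      show "\<exists>a\<in>carrier \<Gamma>. \<forall>v\<in>nodes. r v = (case v of (g, i) \<Rightarrow> (a \<otimes> g, i))"
        if "bij_betw r nodes nodes" "\<And>v. v \<in> nodes \<Longrightarrow> card (star (r v)) = card (star v)"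
          "\<And>u w. u \<in> nodes \<Longrightarrow> w \<in> nodes \<Longrightarrow> adj (r u) (r w) = adj u w" for r
        using graph_rigid[OF that] by fastforce
      show "a \<otimes> \<sigma> = \<sigma> \<otimes> a" if "a \<in> carrier \<Gamma>" for a
        using m_comm[OF that assms(4)] .
    qed (use assms one_closed in \<open>auto simp: nodes_def m_assoc\<close>)
  qed
  then show ?thesis
    unfolding realizes_centrally_def .
qed

end
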